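(* Let $\mathcal A$ be an abelian category and $\mathcal T$ a full subcategory consisting of projective objects which is closed under finite direct sums and direct summands. Let $\underline{\mathcal A}$ be the stable category of $\mathcal A$ associated to $\mathcal T$. The following assertions are equivalent: 1) $\underline{\mathcal A}$ is balanced. 2) If $\mu:K\to M$ is a non-split monomorphism which factors through an object of $\mathcal T$, then there exists a morphism $h:M\to T'$, with $T'\in\mathcal T$, such that no morphism $\tilde h:M\to(h\mu)(K)$ coincides with $h$ on $K$. 3) If $\mu:T\to M$ is a non-split monomorphism with $T\in\mathcal T$, then there exists a morphism $h:M\to T'$, with $T'\in\mathcal T$, such that no morphism $\tilde h:M\to(h\mu)(T)$ coincides with $h$ on $T$. 4) If $f:M\to N$ is an epimorphism satisfying conditions i) and ii) below, then it is a retraction: i) the kernel morphism $f^k:\ker(f)\to M$ factors through an object of $\mathcal T$; ii) for every $h:M\to T$ with $T\in\mathcal T$, the canonical epimorphism $\ker(f)\twoheadrightarrow h(\ker(f))$ factors through $f^k:\ker(f)\to M$. 5) For every non-split epimorphism $f:M\to N$ with $\ker(f)\in\mathcal T$, there exists a morphism $h:M\to T'$, with $T'\in\mathcal T$, such that $\ker(f)+\ker(h-gf)$ is strictly contained in $M$ for all morphisms $g:N\to T'$.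
   Context: The stable category $\underline{\mathcal A}=\mathcal A/\langle\mathcal T\rangle$ has the same objects as $\mathcal A$ and morphisms those of $\mathcal A$ modulo the ideal of morphisms factoring through an object of $\mathcal T$. A category is balanced if every morphism that is both a monomorphism and an epimorphism is an isomorphism. It is not assumed that $\mathcal A$ has enough projectives. Images and sums of subobjects are taken in $\mathcal A$: for $\mu:K\to M$ and $h:M\to T'$, $(h\mu)(K)$ is the image of $h\mu$, with canonical inclusion $j:(h\mu)(K)\hookrightarrow T'$, and "$\tilde h$ coincides with $h$ on $K$" means $j\tilde h\mu=h\mu$. Similarly $h(\ker(f))$ is the image of $hf^k$. A non-split monomorphism (resp. epimorphism) is one which is not a section (resp. not a retraction). *)

theory Defs
  imports "HOL-Algebra.Group"
begin

section \<open>Categories\<close>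

record ('o, 'm) cat =
  Ob :: "'o set"
  Ar :: "'m set"
  Dom :: "'m \<Rightarrow> 'o"
  Cod :: "'m \<Rightarrow> 'o"
  Id :: "'o \<Rightarrow> 'm"
  Comp :: "'m \<Rightarrow> 'm \<Rightarrow> 'm"  (infixr "\<cdot>\<index>" 75)

definition Hom :: "('o, 'm, 'x) cat_scheme \<Rightarrow> 'o \<Rightarrow> 'o \<Rightarrow> 'm set" where
  "Hom C X Y = {f \<in> Ar C. Dom C f = X \<and> Cod C f = Y}"

locale category =
  fixes C :: "('o, 'm, 'x) cat_scheme" (structure)
  assumes dom_in_Ob: "f \<in> Ar C \<Longrightarrow> Dom C f \<in> Ob C"
    and cod_in_Ob: "f \<in> Ar C \<Longrightarrow> Cod C f \<in> Ob C"
    and id_in_Hom: "X \<in> Ob C \<Longrightarrow> Id C X \<in> Hom C X X"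
    and comp_in_Hom: "\<lbrakk>f \<in> Hom C X Y; g \<in> Hom C Y Z\<rbrakk> \<Longrightarrow> g \<cdot> f \<in> Hom C X Z"
    and comp_assoc:
      "\<lbrakk>f \<in> Hom C W X; g \<in> Hom C X Y; h \<in> Hom C Y Z\<rbrakk> \<Longrightarrow> (h \<cdot> g) \<cdot> f = h \<cdot> (g \<cdot> f)"
    and comp_id_right: "f \<in> Hom C X Y \<Longrightarrow> f \<cdot> Id C X = f"
    and comp_id_left: "f \<in> Hom C X Y \<Longrightarrow> Id C Y \<cdot> f = f"

definition is_mono :: "('o, 'm, 'x) cat_scheme \<Rightarrow> 'm \<Rightarrow> bool" where
  "is_mono C f \<longleftrightarrow> f \<in> Ar C \<and>
     (\<forall>X. \<forall>g \<in> Hom C X (Dom C f). \<forall>h \<in> Hom C X (Dom C f).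
        f \<cdot>\<^bsub>C\<^esub> g = f \<cdot>\<^bsub>C\<^esub> h \<longrightarrow> g = h)"

definition is_epi :: "('o, 'm, 'x) cat_scheme \<Rightarrow> 'm \<Rightarrow> bool" where
  "is_epi C f \<longleftrightarrow> f \<in> Ar C \<and>
     (\<forall>Y. \<forall>g \<in> Hom C (Cod C f) Y. \<forall>h \<in> Hom C (Cod C f) Y.
        g \<cdot>\<^bsub>C\<^esub> f = h \<cdot>\<^bsub>C\<^esub> f \<longrightarrow> g = h)"

definition is_section :: "('o, 'm, 'x) cat_scheme \<Rightarrow> 'm \<Rightarrow> bool" where
  "is_section C f \<longleftrightarrow> f \<in> Ar C \<and>
     (\<exists>r \<in> Hom C (Cod C f) (Dom C f). r \<cdot>\<^bsub>C\<^esub> f = Id C (Dom C f))"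

definition is_retraction :: "('o, 'm, 'x) cat_scheme \<Rightarrow> 'm \<Rightarrow> bool" where
  "is_retraction C f \<longleftrightarrow> f \<in> Ar C \<and>
     (\<exists>s \<in> Hom C (Cod C f) (Dom C f). f \<cdot>\<^bsub>C\<^esub> s = Id C (Cod C f))"

definition is_iso :: "('o, 'm, 'x) cat_scheme \<Rightarrow> 'm \<Rightarrow> bool" where
  "is_iso C f \<longleftrightarrow> f \<in> Ar C \<and>
     (\<exists>g \<in> Hom C (Cod C f) (Dom C f).
        g \<cdot>\<^bsub>C\<^esub> f = Id C (Dom C f) \<and> f \<cdot>\<^bsub>C\<^esub> g = Id C (Cod C f))"

definition balanced :: "('o, 'm, 'x) cat_scheme \<Rightarrow> bool" where
  "balanced C \<longleftrightarrow> (\<forall>f. is_mono C f \<and> is_epi C f \<longrightarrow> is_iso C f)"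

definition is_projective :: "('o, 'm, 'x) cat_scheme \<Rightarrow> 'o \<Rightarrow> bool" where
  "is_projective C P \<longleftrightarrow> P \<in> Ob C \<and>
     (\<forall>e. is_epi C e \<longrightarrow>
        (\<forall>f \<in> Hom C P (Cod C e). \<exists>g \<in> Hom C P (Dom C e). e \<cdot>\<^bsub>C\<^esub> g = f))"

definition is_zero_object :: "('o, 'm, 'x) cat_scheme \<Rightarrow> 'o \<Rightarrow> bool" where
  "is_zero_object C Z \<longleftrightarrow> Z \<in> Ob C \<and>
     (\<forall>X \<in> Ob C. (\<exists>!f. f \<in> Hom C Z X) \<and> (\<exists>!f. f \<in> Hom C X Z))"

definition factors_through_class ::
    "('o, 'm, 'x) cat_scheme \<Rightarrow> 'o set \<Rightarrow> 'm \<Rightarrow> bool" where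
  "factors_through_class C T f \<longleftrightarrow> f \<in> Ar C \<and>
     (\<exists>X \<in> T. \<exists>a \<in> Hom C (Dom C f) X. \<exists>b \<in> Hom C X (Cod C f). f = b \<cdot>\<^bsub>C\<^esub> a)"


section \<open>Abelian categories\<close>

text \<open>\<open>Add\<close> is only meaningful on parallel arrows; \<open>Zero C X Y\<close> is the zero morphism
  from \<open>X\<close> to \<open>Y\<close>.\<close>

record ('o, 'm) abcat = "('o, 'm) cat" +
  Add :: "'m \<Rightarrow> 'm \<Rightarrow> 'm"  (infixl "\<boxplus>\<index>" 65)
  Zero :: "'o \<Rightarrow> 'o \<Rightarrow> 'm"

definition hom_group :: "('o, 'm, 'x) abcat_scheme \<Rightarrow> 'o \<Rightarrow> 'o \<Rightarrow> 'm monoid" where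
  "hom_group C X Y = \<lparr>carrier = Hom C X Y, monoid.mult = Add C, one = Zero C X Y\<rparr>"

definition Diff :: "('o, 'm, 'x) abcat_scheme \<Rightarrow> 'm \<Rightarrow> 'm \<Rightarrow> 'm"  (infixl "\<boxminus>\<index>" 65) where
  "f \<boxminus>\<^bsub>C\<^esub> g = f \<boxplus>\<^bsub>C\<^esub> inv\<^bsub>hom_group C (Dom C g) (Cod C g)\<^esub> g"

definition is_kernel :: "('o, 'm, 'x) abcat_scheme \<Rightarrow> 'm \<Rightarrow> 'm \<Rightarrow> bool" where
  "is_kernel C f k \<longleftrightarrow> f \<in> Ar C \<and> k \<in> Ar C \<and> Cod C k = Dom C f \<and>
     f \<cdot>\<^bsub>C\<^esub> k = Zero C (Dom C k) (Cod C f) \<and>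
     (\<forall>X. \<forall>x \<in> Hom C X (Dom C f). f \<cdot>\<^bsub>C\<^esub> x = Zero C X (Cod C f) \<longrightarrow>
        (\<exists>!u. u \<in> Hom C X (Dom C k) \<and> k \<cdot>\<^bsub>C\<^esub> u = x))"

definition is_cokernel :: "('o, 'm, 'x) abcat_scheme \<Rightarrow> 'm \<Rightarrow> 'm \<Rightarrow> bool" where
  "is_cokernel C f c \<longleftrightarrow> f \<in> Ar C \<and> c \<in> Ar C \<and> Dom C c = Cod C f \<and>
     c \<cdot>\<^bsub>C\<^esub> f = Zero C (Dom C f) (Cod C c) \<and>
     (\<forall>Y. \<forall>y \<in> Hom C (Cod C f) Y. y \<cdot>\<^bsub>C\<^esub> f = Zero C (Dom C f) Y \<longrightarrow>
        (\<exists>!u. u \<in> Hom C (Cod C c) Y \<and> u \<cdot>\<^bsub>C\<^esub> c = y))"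

definition is_direct_sum ::
    "('o, 'm, 'x) abcat_scheme \<Rightarrow> 'o \<Rightarrow> 'o \<Rightarrow> 'o \<Rightarrow> 'm \<Rightarrow> 'm \<Rightarrow> 'm \<Rightarrow> 'm \<Rightarrow> bool" where
  "is_direct_sum C X Y S i\<^sub>1 i\<^sub>2 p\<^sub>1 p\<^sub>2 \<longleftrightarrow>
     X \<in> Ob C \<and> Y \<in> Ob C \<and> S \<in> Ob C \<and>
     i\<^sub>1 \<in> Hom C X S \<and> i\<^sub>2 \<in> Hom C Y S \<and> p\<^sub>1 \<in> Hom C S X \<and> p\<^sub>2 \<in> Hom C S Y \<and>
     p\<^sub>1 \<cdot>\<^bsub>C\<^esub> i\<^sub>1 = Id C X \<and> p\<^sub>2 \<cdot>\<^bsub>C\<^esub> i\<^sub>2 = Id C Y \<and>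
     p\<^sub>1 \<cdot>\<^bsub>C\<^esub> i\<^sub>2 = Zero C Y X \<and> p\<^sub>2 \<cdot>\<^bsub>C\<^esub> i\<^sub>1 = Zero C X Y \<and>
     (i\<^sub>1 \<cdot>\<^bsub>C\<^esub> p\<^sub>1) \<boxplus>\<^bsub>C\<^esub> (i\<^sub>2 \<cdot>\<^bsub>C\<^esub> p\<^sub>2) = Id C S"

locale preadditive_category = category C
  for C :: "('o, 'm, 'x) abcat_scheme" (structure) +
  assumes hom_comm_group: "\<lbrakk>X \<in> Ob C; Y \<in> Ob C\<rbrakk> \<Longrightarrow> comm_group (hom_group C X Y)"
    and comp_add_left: "\<lbrakk>f \<in> Hom C X Y; g \<in> Hom C Y Z; g' \<in> Hom C Y Z\<rbrakk> \<Longrightarrow>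
      (g \<boxplus> g') \<cdot> f = (g \<cdot> f) \<boxplus> (g' \<cdot> f)"
    and comp_add_right: "\<lbrakk>f \<in> Hom C X Y; f' \<in> Hom C X Y; g \<in> Hom C Y Z\<rbrakk> \<Longrightarrow>
      g \<cdot> (f \<boxplus> f') = (g \<cdot> f) \<boxplus> (g \<cdot> f')"

locale additive_category = preadditive_category +
  assumes ex_zero_object: "\<exists>Z. is_zero_object C Z"
    and ex_direct_sum: "\<lbrakk>X \<in> Ob C; Y \<in> Ob C\<rbrakk> \<Longrightarrow>
      \<exists>S i\<^sub>1 i\<^sub>2 p\<^sub>1 p\<^sub>2. is_direct_sum C X Y S i\<^sub>1 i\<^sub>2 p\<^sub>1 p\<^sub>2"

locale abelian_category = additive_category +
  assumes ex_kernel: "f \<in> Ar C \<Longrightarrow> \<exists>k. is_kernel C f k"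
    and ex_cokernel: "f \<in> Ar C \<Longrightarrow> \<exists>c. is_cokernel C f c"
    and mono_is_kernel: "is_mono C m \<Longrightarrow> \<exists>f. is_kernel C f m"
    and epi_is_cokernel: "is_epi C e \<Longrightarrow> \<exists>f. is_cokernel C f e"


section \<open>Kernels, images and sums of subobjects\<close>

text \<open>Kernels, cokernels, images and sums are determined up to isomorphism only; the
  following operations pick one representative.\<close>

definition ker_mor :: "('o, 'm, 'x) abcat_scheme \<Rightarrow> 'm \<Rightarrow> 'm" where
  "ker_mor C f = (SOME k. is_kernel C f k)"

definition Ker :: "('o, 'm, 'x) abcat_scheme \<Rightarrow> 'm \<Rightarrow> 'o" where
  "Ker C f = Dom C (ker_mor C f)"

definition coker_mor :: "('o, 'm, 'x) abcat_scheme \<Rightarrow> 'm \<Rightarrow> 'm" where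
  "coker_mor C f = (SOME c. is_cokernel C f c)"

definition img_incl :: "('o, 'm, 'x) abcat_scheme \<Rightarrow> 'm \<Rightarrow> 'm" where
  "img_incl C f = ker_mor C (coker_mor C f)"

definition Img :: "('o, 'm, 'x) abcat_scheme \<Rightarrow> 'm \<Rightarrow> 'o" where
  "Img C f = Dom C (img_incl C f)"

definition img_proj :: "('o, 'm, 'x) abcat_scheme \<Rightarrow> 'm \<Rightarrow> 'm" where
  "img_proj C f = (THE p. p \<in> Hom C (Dom C f) (Img C f) \<and> img_incl C f \<cdot>\<^bsub>C\<^esub> p = f)"

text \<open>The sum of two subobjects \<open>u : U \<rightarrow> M\<close> and \<open>v : V \<rightarrow> M\<close>, as the inclusion into \<open>M\<close>
  of the image of the induced morphism \<open>U \<oplus> V \<rightarrow> M\<close>.\<close>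

definition subobject_sum :: "('o, 'm, 'x) abcat_scheme \<Rightarrow> 'm \<Rightarrow> 'm \<Rightarrow> 'm" where
  "subobject_sum C u v = (SOME s. \<exists>S i\<^sub>1 i\<^sub>2 p\<^sub>1 p\<^sub>2.
     is_direct_sum C (Dom C u) (Dom C v) S i\<^sub>1 i\<^sub>2 p\<^sub>1 p\<^sub>2 \<and>
     s = img_incl C ((u \<cdot>\<^bsub>C\<^esub> p\<^sub>1) \<boxplus>\<^bsub>C\<^esub> (v \<cdot>\<^bsub>C\<^esub> p\<^sub>2)))"

definition proper_subobject :: "('o, 'm, 'x) cat_scheme \<Rightarrow> 'm \<Rightarrow> bool" where
  "proper_subobject C s \<longleftrightarrow> is_mono C s \<and> \<not> is_iso C s"


section \<open>The stable category\<close>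

text \<open>A full subcategory is given by its set of objects. Closure under the empty direct sum
  (a zero object) and under binary ones amounts to closure under all finite ones. Direct
  sums are taken up to isomorphism.\<close>

definition closed_under_finite_direct_sums ::
    "('o, 'm, 'x) abcat_scheme \<Rightarrow> 'o set \<Rightarrow> bool" where
  "closed_under_finite_direct_sums C T \<longleftrightarrow>
     (\<forall>Z. is_zero_object C Z \<longrightarrow> Z \<in> T) \<and>
     (\<forall>X \<in> T. \<forall>Y \<in> T. \<forall>S i\<^sub>1 i\<^sub>2 p\<^sub>1 p\<^sub>2. is_direct_sum C X Y S i\<^sub>1 i\<^sub>2 p\<^sub>1 p\<^sub>2 \<longrightarrow> S \<in> T)"

definition closed_under_direct_summands ::
    "('o, 'm, 'x) abcat_scheme \<Rightarrow> 'o set \<Rightarrow> bool" where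
  "closed_under_direct_summands C T \<longleftrightarrow>
     (\<forall>S \<in> T. \<forall>X Y i\<^sub>1 i\<^sub>2 p\<^sub>1 p\<^sub>2. is_direct_sum C X Y S i\<^sub>1 i\<^sub>2 p\<^sub>1 p\<^sub>2 \<longrightarrow> X \<in> T)"

definition stable_rel :: "('o, 'm, 'x) abcat_scheme \<Rightarrow> 'o set \<Rightarrow> ('m \<times> 'm) set" where
  "stable_rel C T = {(f, g). f \<in> Ar C \<and> g \<in> Ar C \<and> Dom C f = Dom C g \<and> Cod C f = Cod C g \<and>
     factors_through_class C T (f \<boxminus>\<^bsub>C\<^esub> g)}"

text \<open>An arrow of the stable category is a class of parallel arrows, so its domain and
  codomain can be read off from any representative.\<close>

definition stable_category ::
    "('o, 'm, 'x) abcat_scheme \<Rightarrow> 'o set \<Rightarrow> ('o, 'm set) cat" where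
  "stable_category C T =
     \<lparr>Ob = Ob C,
      Ar = Ar C // stable_rel C T,
      Dom = (\<lambda>F. Dom C (SOME f. f \<in> F)),
      Cod = (\<lambda>F. Cod C (SOME f. f \<in> F)),
      Id = (\<lambda>X. stable_rel C T `` {Id C X}),
      Comp = (\<lambda>G F. \<Union>g \<in> G. \<Union>f \<in> F. stable_rel C T `` {g \<cdot>\<^bsub>C\<^esub> f})\<rparr>"

definition all_equivalent :: "bool list \<Rightarrow> bool" where
  "all_equivalent Ps \<longleftrightarrow> (\<forall>P \<in> set Ps. \<forall>Q \<in> set Ps. P \<longleftrightarrow> Q)"

end

theory Submission
  imports Defs
begin

text \<open>All five conditions say that certain arrows split, and the proof consists in recognising
  that they are the same arrows.

  Call \<open>\<mu> : K \<rightarrow> M\<close> an arrow with the extension property if for every \<open>h : M \<rightarrow> T\<close> with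
  \<open>T \<in> \<T>\<close> the restriction of \<open>h\<close> to \<open>K\<close> extends to an arrow \<open>e\<close> on \<open>M\<close> whose values stay in
  \<open>(h\<mu>)(K)\<close>. Conditions 2 and 3 say that monomorphisms with this property split, if they factor
  through \<open>\<T>\<close> or start in \<open>\<T>\<close> respectively. Conditions 4 and 5 say the same for kernels of
  epimorphisms: in condition 4 this is a rewording (\<open>condition_ii_iff\<close>). In condition 5 the
  possible extensions of \<open>h\<close> from \<open>ker f\<close> are the arrows \<open>e = h - gf\<close>, and \<open>ker f + ker e = M\<close>
  means precisely \<open>e(ker f) = e(M)\<close> (\<open>sum_with_kernel_iff\<close>). As a monomorphism splits if and
  only if its cokernel does, 2 is equivalent to 4, and 3 to 5.

  Condition 3 is the special case \<open>K \<in> \<T>\<close> of condition 2. Conversely, if \<open>\<mu> = ba\<close> with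
  \<open>a : K \<rightarrow> P\<close> and \<open>P \<in> \<T>\<close>, then pushing \<open>\<mu>\<close> out along \<open>a\<close> yields a monomorphism from \<open>P\<close>
  that still has the extension property (\<open>pushout_to_\<T>\<close>). If this one splits, then \<open>a\<close> extends to
  some \<open>g : M \<rightarrow> P\<close>; the extension property of \<open>\<mu>\<close>, applied to \<open>g\<close>, makes \<open>a\<close> extend with values
  in \<open>a(K)\<close>, which is isomorphic to \<open>K\<close>. So \<open>\<mu>\<close> splits (\<open>section_if_extends_factor\<close>).

  For condition 1, an epimorphism \<open>f\<close> with kernel \<open>k\<close> is stably a monomorphism if and only if
  \<open>k\<close> factors through \<open>\<T>\<close> (\<open>epi_stably_mono_iff\<close>), and stably an epimorphism if and only if
  \<open>k\<close> has the extension property (\<open>epi_stably_epi_iff\<close>); and it is a stable isomorphism only if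
  it is a retraction (\<open>epi_stably_iso_retraction\<close>). An arbitrary stable bimorphism is reduced to an
  epimorphism by adding an object of \<open>\<T>\<close> to its domain (\<open>stably_epi_completion\<close>). Thus 1 is
  equivalent to 4.\<close>

section \<open>Calculus of arrows\<close>

context category
begin

lemma comp_Ar: "\<lbrakk>f \<in> Ar C; g \<in> Ar C; Cod C f = Dom C g\<rbrakk> \<Longrightarrow> g \<cdot> f \<in> Ar C"
  and comp_Dom: "\<lbrakk>f \<in> Ar C; g \<in> Ar C; Cod C f = Dom C g\<rbrakk> \<Longrightarrow> Dom C (g \<cdot> f) = Dom C f"
  and comp_Cod: "\<lbrakk>f \<in> Ar C; g \<in> Ar C; Cod C f = Dom C g\<rbrakk> \<Longrightarrow> Cod C (g \<cdot> f) = Cod C g"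
  using comp_in_Hom[of f "Dom C f" "Cod C f" g "Cod C g"] by (auto simp: Hom_def)

lemma comp_assoc_Ar:
  "\<lbrakk>f \<in> Ar C; g \<in> Ar C; h \<in> Ar C; Cod C f = Dom C g; Cod C g = Dom C h\<rbrakk>
    \<Longrightarrow> (h \<cdot> g) \<cdot> f = h \<cdot> (g \<cdot> f)"
  using comp_assoc[of f "Dom C f" "Cod C f" g "Cod C g" h "Cod C h"] by (simp add: Hom_def)

lemma Id_Ar: "X \<in> Ob C \<Longrightarrow> Id C X \<in> Ar C"
  and Id_Dom: "X \<in> Ob C \<Longrightarrow> Dom C (Id C X) = X"
  and Id_Cod: "X \<in> Ob C \<Longrightarrow> Cod C (Id C X) = X"
  using id_in_Hom[of X] by (auto simp: Hom_def)

lemma comp_Id_Ar: "\<lbrakk>f \<in> Ar C; X = Dom C f\<rbrakk> \<Longrightarrow> f \<cdot> Id C X = f"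
  and Id_comp_Ar: "\<lbrakk>f \<in> Ar C; X = Cod C f\<rbrakk> \<Longrightarrow> Id C X \<cdot> f = f"
  using comp_id_right[of f "Dom C f" "Cod C f"] comp_id_left[of f "Dom C f" "Cod C f"]
  by (auto simp: Hom_def)

text \<open>Stated with \<open>Ar\<close>, \<open>Dom\<close> and \<open>Cod\<close> instead of \<open>Hom\<close>, the rules leave no object for
  unification to guess, so the simplifier can discharge their premises.\<close>

lemmas cat_simps = Hom_def dom_in_Ob cod_in_Ob comp_Ar comp_Dom comp_Cod comp_assoc_Ar
  Id_Ar Id_Dom Id_Cod comp_Id_Ar Id_comp_Ar

text \<open>Rewriting with a known composite inside a longer one, since associativity is used to
  nest composites to the right.\<close>

lemma comp_reassoc:
  assumes "f \<in> Ar C" "g \<in> Ar C" "Cod C f = Dom C g" "g \<cdot> f = k"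
    and "u \<in> Ar C" "Cod C u = Dom C f"
  shows "g \<cdot> (f \<cdot> u) = k \<cdot> u"
  using assms comp_assoc_Ar[of u f g] by simp

lemma mono_cancel:
  assumes "is_mono C f" "f \<cdot> g = f \<cdot> h" "g \<in> Hom C X (Dom C f)" "h \<in> Hom C X (Dom C f)"
  shows "g = h"
  using assms unfolding is_mono_def by blast

lemma mono_comp_eq_self:
  assumes "is_mono C f" "f \<cdot> x = f" "x \<in> Hom C (Dom C f) (Dom C f)"
  shows "x = Id C (Dom C f)"
proof (rule mono_cancel[OF assms(1) _ assms(3)])
  have f: "f \<in> Ar C" using assms(1) by (simp add: is_mono_def)
  then show "f \<cdot> x = f \<cdot> Id C (Dom C f)" using assms(2) by (simp add: cat_simps)
  show "Id C (Dom C f) \<in> Hom C (Dom C f) (Dom C f)" using f by (simp add: cat_simps)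
qed

lemma epi_cancel:
  assumes "is_epi C f" "g \<cdot> f = h \<cdot> f" "g \<in> Hom C (Cod C f) Y" "h \<in> Hom C (Cod C f) Y"
  shows "g = h"
  using assms unfolding is_epi_def by blast

end

context preadditive_category
begin

lemma add_Ar: "\<lbrakk>f \<in> Ar C; g \<in> Ar C; Dom C f = Dom C g; Cod C f = Cod C g\<rbrakk> \<Longrightarrow> f \<boxplus> g \<in> Ar C"
  and add_Dom: "\<lbrakk>f \<in> Ar C; g \<in> Ar C; Dom C f = Dom C g; Cod C f = Cod C g\<rbrakk>
    \<Longrightarrow> Dom C (f \<boxplus> g) = Dom C g"
  and add_Cod: "\<lbrakk>f \<in> Ar C; g \<in> Ar C; Dom C f = Dom C g; Cod C f = Cod C g\<rbrakk>
    \<Longrightarrow> Cod C (f \<boxplus> g) = Cod C g"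
proof -
  assume a: "f \<in> Ar C" "g \<in> Ar C" "Dom C f = Dom C g" "Cod C f = Cod C g"
  interpret G: comm_group "hom_group C (Dom C g) (Cod C g)"
    using a by (intro hom_comm_group) (auto simp: cat_simps)
  have "f \<boxplus> g \<in> Hom C (Dom C g) (Cod C g)"
    using G.m_closed[of f g] a by (simp add: hom_group_def Hom_def)
  then show "f \<boxplus> g \<in> Ar C" "Dom C (f \<boxplus> g) = Dom C g" "Cod C (f \<boxplus> g) = Cod C g"
    by (auto simp: Hom_def)
qed

lemma zero_Ar: "\<lbrakk>X \<in> Ob C; Y \<in> Ob C\<rbrakk> \<Longrightarrow> Zero C X Y \<in> Ar C"
  and zero_Dom: "\<lbrakk>X \<in> Ob C; Y \<in> Ob C\<rbrakk> \<Longrightarrow> Dom C (Zero C X Y) = X"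
  and zero_Cod: "\<lbrakk>X \<in> Ob C; Y \<in> Ob C\<rbrakk> \<Longrightarrow> Cod C (Zero C X Y) = Y"
proof -
  assume a: "X \<in> Ob C" "Y \<in> Ob C"
  interpret G: comm_group "hom_group C X Y" using a by (rule hom_comm_group)
  have "Zero C X Y \<in> Hom C X Y" using G.one_closed by (simp add: hom_group_def)
  then show "Zero C X Y \<in> Ar C" "Dom C (Zero C X Y) = X" "Cod C (Zero C X Y) = Y"
    by (auto simp: Hom_def)
qed

lemma diff_Ar: "\<lbrakk>f \<in> Ar C; g \<in> Ar C; Dom C f = Dom C g; Cod C f = Cod C g\<rbrakk> \<Longrightarrow> f \<boxminus> g \<in> Ar C"
  and diff_Dom: "\<lbrakk>f \<in> Ar C; g \<in> Ar C; Dom C f = Dom C g; Cod C f = Cod C g\<rbrakk>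
    \<Longrightarrow> Dom C (f \<boxminus> g) = Dom C g"
  and diff_Cod: "\<lbrakk>f \<in> Ar C; g \<in> Ar C; Dom C f = Dom C g; Cod C f = Cod C g\<rbrakk>
    \<Longrightarrow> Cod C (f \<boxminus> g) = Cod C g"
  and diff_add_cancel: "\<lbrakk>f \<in> Ar C; g \<in> Ar C; Dom C f = Dom C g; Cod C f = Cod C g\<rbrakk>
    \<Longrightarrow> (f \<boxminus> g) \<boxplus> g = f"
  and add_diff_cancel: "\<lbrakk>f \<in> Ar C; g \<in> Ar C; Dom C f = Dom C g; Cod C f = Cod C g\<rbrakk>
    \<Longrightarrow> (f \<boxplus> g) \<boxminus> g = f"
  and diff_diff_cancel: "\<lbrakk>f \<in> Ar C; g \<in> Ar C; Dom C f = Dom C g; Cod C f = Cod C g\<rbrakk>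
    \<Longrightarrow> f \<boxminus> (f \<boxminus> g) = g"
  and diff_eq_zero: "\<lbrakk>f \<in> Ar C; g \<in> Ar C; Dom C f = Dom C g; Cod C f = Cod C g\<rbrakk>
    \<Longrightarrow> f \<boxminus> g = Zero C (Dom C g) (Cod C g) \<longleftrightarrow> f = g"
  and add_zero: "f \<in> Ar C \<Longrightarrow> f \<boxplus> Zero C (Dom C f) (Cod C f) = f"
  and add_idem: "\<lbrakk>f \<in> Ar C; f \<boxplus> f = f\<rbrakk> \<Longrightarrow> f = Zero C (Dom C f) (Cod C f)"
  and zero_add: "f \<in> Ar C \<Longrightarrow> Zero C (Dom C f) (Cod C f) \<boxplus> f = f"
  and diff_zero: "f \<in> Ar C \<Longrightarrow> f \<boxminus> Zero C (Dom C f) (Cod C f) = f"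
proof -
  have H: "comm_group (hom_group C (Dom C f) (Cod C f))" if "f \<in> Ar C"
    using that by (intro hom_comm_group) (auto simp: cat_simps)
  { assume a: "f \<in> Ar C"
    interpret G: comm_group "hom_group C (Dom C f) (Cod C f)" using H a by blast
    let ?z = "Zero C (Dom C f) (Cod C f)"
    have z: "?z \<in> Ar C" "Dom C ?z = Dom C f" "Cod C ?z = Cod C f"
      using a by (auto simp: zero_Ar zero_Dom zero_Cod cat_simps)
    show "f \<boxplus> ?z = f" "?z \<boxplus> f = f" "f \<boxminus> ?z = f"
      using G.r_one[of f] G.l_one[of f] G.inv_one a z
      by (simp_all add: hom_group_def Hom_def Diff_def)
    show "f = ?z" if "f \<boxplus> f = f"
      using G.r_cancel_one[of f f] a that by (simp add: hom_group_def Hom_def) }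
  assume a: "f \<in> Ar C" "g \<in> Ar C" "Dom C f = Dom C g" "Cod C f = Cod C g"
  let ?G = "hom_group C (Dom C g) (Cod C g)"
  interpret G: comm_group ?G using H[OF a(1)] a by simp
  have D: "u \<boxminus> v = u \<otimes>\<^bsub>?G\<^esub> inv\<^bsub>?G\<^esub> v" if "v \<in> carrier ?G" for u v
    using that by (auto simp: Diff_def hom_group_def Hom_def)
  have P: "u \<boxplus> v = u \<otimes>\<^bsub>?G\<^esub> v" for u v by (simp add: hom_group_def)
  have Z: "Zero C (Dom C g) (Cod C g) = \<one>\<^bsub>?G\<^esub>" by (simp add: hom_group_def)
  have fg: "f \<in> carrier ?G" "g \<in> carrier ?G" using a by (auto simp: hom_group_def Hom_def)
  have c: "f \<boxminus> g \<in> carrier ?G" using fg by (simp add: D)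
  then show "f \<boxminus> g \<in> Ar C" "Dom C (f \<boxminus> g) = Dom C g" "Cod C (f \<boxminus> g) = Cod C g"
    by (auto simp: Hom_def hom_group_def)
  show "(f \<boxminus> g) \<boxplus> g = f" unfolding P D[OF fg(2)] using fg by (simp add: G.m_assoc)
  show "(f \<boxplus> g) \<boxminus> g = f" unfolding P D[OF fg(2)] using fg by (simp add: G.m_assoc)
  have "f \<boxminus> (f \<boxminus> g) = f \<otimes>\<^bsub>?G\<^esub> inv\<^bsub>?G\<^esub> (f \<otimes>\<^bsub>?G\<^esub> inv\<^bsub>?G\<^esub> g)"
    using D[OF c, of f] D[OF fg(2), of f] by simp
  then show "f \<boxminus> (f \<boxminus> g) = g" using fg by (simp add: G.inv_mult G.m_assoc[symmetric])
  show "f \<boxminus> g = Zero C (Dom C g) (Cod C g) \<longleftrightarrow> f = g"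
    unfolding Z D[OF fg(2)] using fg G.inv_equality G.inv_inv by (metis G.inv_closed G.r_inv)
qed

lemma diff_chain:
  assumes "f \<in> Ar C" "g \<in> Ar C" "h \<in> Ar C" "Dom C f = Dom C g" "Cod C f = Cod C g"
    "Dom C h = Dom C g" "Cod C h = Cod C g"
  shows "(f \<boxminus> h) \<boxminus> (g \<boxminus> h) = f \<boxminus> g"
proof -
  let ?G = "hom_group C (Dom C g) (Cod C g)"
  interpret G: comm_group ?G using assms by (intro hom_comm_group) (auto simp: cat_simps)
  have D: "u \<boxminus> v = u \<otimes>\<^bsub>?G\<^esub> inv\<^bsub>?G\<^esub> v" if "v \<in> carrier ?G" for u v
    using that by (auto simp: Diff_def hom_group_def Hom_def)
  have fg: "f \<in> carrier ?G" "g \<in> carrier ?G" "h \<in> carrier ?G"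
    using assms by (auto simp: hom_group_def Hom_def)
  have c: "g \<boxminus> h \<in> carrier ?G" using fg by (simp add: D)
  have ac: "(a \<otimes>\<^bsub>?G\<^esub> b) \<otimes>\<^bsub>?G\<^esub> (c \<otimes>\<^bsub>?G\<^esub> d) = (a \<otimes>\<^bsub>?G\<^esub> c) \<otimes>\<^bsub>?G\<^esub> (d \<otimes>\<^bsub>?G\<^esub> b)"
    if "a \<in> carrier ?G" "b \<in> carrier ?G" "c \<in> carrier ?G" "d \<in> carrier ?G" for a b c d
    using that by (simp add: G.m_ac)
  have "(f \<boxminus> h) \<boxminus> (g \<boxminus> h) = (f \<otimes>\<^bsub>?G\<^esub> inv\<^bsub>?G\<^esub> h) \<otimes>\<^bsub>?G\<^esub> inv\<^bsub>?G\<^esub> (g \<otimes>\<^bsub>?G\<^esub> inv\<^bsub>?G\<^esub> h)"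
    using D[OF c, of "f \<boxminus> h"] D[OF fg(3)] by simp
  also have "\<dots> = f \<otimes>\<^bsub>?G\<^esub> inv\<^bsub>?G\<^esub> g \<otimes>\<^bsub>?G\<^esub> (h \<otimes>\<^bsub>?G\<^esub> inv\<^bsub>?G\<^esub> h)"
    using fg ac[of f "inv\<^bsub>?G\<^esub> h" "inv\<^bsub>?G\<^esub> g" h] by (simp add: G.inv_mult)
  also have "\<dots> = f \<boxminus> g" using fg D[OF fg(2)] by simp
  finally show ?thesis .
qed

lemma comp_add: "\<lbrakk>f \<in> Ar C; f' \<in> Ar C; g \<in> Ar C; Dom C f = Dom C f'; Cod C f = Cod C f';
    Cod C f' = Dom C g\<rbrakk> \<Longrightarrow> g \<cdot> (f \<boxplus> f') = (g \<cdot> f) \<boxplus> (g \<cdot> f')"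
  by (rule comp_add_right) (auto simp: Hom_def)

lemma add_comp: "\<lbrakk>f \<in> Ar C; g \<in> Ar C; g' \<in> Ar C; Dom C g = Dom C g'; Cod C g = Cod C g';
    Cod C f = Dom C g'\<rbrakk> \<Longrightarrow> (g \<boxplus> g') \<cdot> f = (g \<cdot> f) \<boxplus> (g' \<cdot> f)"
  by (rule comp_add_left) (auto simp: Hom_def)

lemmas add_simps = cat_simps add_Ar add_Dom add_Cod zero_Ar zero_Dom zero_Cod
  diff_Ar diff_Dom diff_Cod comp_add add_comp

lemma zero_add_zero: "\<lbrakk>X \<in> Ob C; Y \<in> Ob C\<rbrakk> \<Longrightarrow> Zero C X Y \<boxplus> Zero C X Y = Zero C X Y"
  using add_zero[of "Zero C X Y"] by (simp add: add_simps)

lemma add_diff_swap: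
  assumes "f \<in> Ar C" "g \<in> Ar C" "Dom C f = Dom C g" "Cod C f = Cod C g"
  shows "g \<boxplus> (f \<boxminus> g) = f"
proof -
  let ?G = "hom_group C (Dom C g) (Cod C g)"
  interpret G: comm_group ?G using assms by (intro hom_comm_group) (auto simp: cat_simps)
  have "g \<in> carrier ?G" "f \<boxminus> g \<in> carrier ?G"
    using assms by (auto simp: hom_group_def add_simps)
  then have "g \<boxplus> (f \<boxminus> g) = (f \<boxminus> g) \<boxplus> g" using G.m_comm by (simp add: hom_group_def)
  then show ?thesis using assms by (simp add: diff_add_cancel)
qed

lemma comp_zero:
  assumes "g \<in> Ar C" "X \<in> Ob C" "Y = Dom C g"
  shows "g \<cdot> Zero C X Y = Zero C X (Cod C g)"
proof -
  have "g \<cdot> Zero C X Y \<boxplus> g \<cdot> Zero C X Y = g \<cdot> (Zero C X Y \<boxplus> Zero C X Y)"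
    using assms by (simp add: add_simps)
  also have "\<dots> = g \<cdot> Zero C X Y" using assms by (simp add: zero_add_zero add_simps)
  finally show ?thesis using add_idem[of "g \<cdot> Zero C X Y"] assms by (simp add: add_simps)
qed

lemma zero_comp:
  assumes "f \<in> Ar C" "Y \<in> Ob C" "X = Cod C f"
  shows "Zero C X Y \<cdot> f = Zero C (Dom C f) Y"
proof -
  have "Zero C X Y \<cdot> f \<boxplus> Zero C X Y \<cdot> f = (Zero C X Y \<boxplus> Zero C X Y) \<cdot> f"
    using assms by (simp add: add_simps)
  also have "\<dots> = Zero C X Y \<cdot> f" using assms by (simp add: zero_add_zero add_simps)
  finally show ?thesis using add_idem[of "Zero C X Y \<cdot> f"] assms by (simp add: add_simps)
qed

lemma comp_diff:
  assumes "f \<in> Ar C" "f' \<in> Ar C" "g \<in> Ar C" "Dom C f = Dom C f'" "Cod C f = Cod C f'"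
    "Cod C f' = Dom C g"
  shows "g \<cdot> (f \<boxminus> f') = (g \<cdot> f) \<boxminus> (g \<cdot> f')"
proof -
  have "g \<cdot> f = g \<cdot> (f \<boxminus> f') \<boxplus> g \<cdot> f'"
    using assms comp_add[of "f \<boxminus> f'" f' g] by (simp add: add_simps diff_add_cancel)
  then show ?thesis using assms by (simp add: add_simps add_diff_cancel)
qed

lemma diff_comp:
  assumes "f \<in> Ar C" "g \<in> Ar C" "g' \<in> Ar C" "Dom C g = Dom C g'" "Cod C g = Cod C g'"
    "Cod C f = Dom C g'"
  shows "(g \<boxminus> g') \<cdot> f = (g \<cdot> f) \<boxminus> (g' \<cdot> f)"
proof -
  have "g \<cdot> f = (g \<boxminus> g') \<cdot> f \<boxplus> g' \<cdot> f"
    using assms add_comp[of f "g \<boxminus> g'" g'] by (simp add: add_simps diff_add_cancel)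
  then show ?thesis using assms by (simp add: add_simps add_diff_cancel)
qed

lemma add_right_zero: "\<lbrakk>f \<in> Ar C; X = Dom C f; Y = Cod C f\<rbrakk> \<Longrightarrow> f \<boxplus> Zero C X Y = f"
  and add_left_zero: "\<lbrakk>f \<in> Ar C; X = Dom C f; Y = Cod C f\<rbrakk> \<Longrightarrow> Zero C X Y \<boxplus> f = f"
  and diff_right_zero: "\<lbrakk>f \<in> Ar C; X = Dom C f; Y = Cod C f\<rbrakk> \<Longrightarrow> f \<boxminus> Zero C X Y = f"
  and diff_same: "f \<in> Ar C \<Longrightarrow> f \<boxminus> f = Zero C (Dom C f) (Cod C f)"
  by (simp_all add: add_zero zero_add diff_zero diff_eq_zero)

lemma add_zero_diff:
  assumes "f \<in> Ar C" "g \<in> Ar C" "Dom C f = X" "Dom C g = X" "Cod C f = Y" "Cod C g = Y"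
  shows "f \<boxplus> (Zero C X Y \<boxminus> g) = f \<boxminus> g"
proof -
  let ?G = "hom_group C X Y"
  interpret G: comm_group ?G using assms by (intro hom_comm_group) (auto simp: cat_simps)
  have D: "u \<boxminus> g = u \<otimes>\<^bsub>?G\<^esub> inv\<^bsub>?G\<^esub> g" for u using assms by (simp add: Diff_def hom_group_def)
  have "f \<boxplus> (Zero C X Y \<boxminus> g) = f \<otimes>\<^bsub>?G\<^esub> (\<one>\<^bsub>?G\<^esub> \<otimes>\<^bsub>?G\<^esub> inv\<^bsub>?G\<^esub> g)"
    unfolding D by (simp add: hom_group_def)
  moreover have "g \<in> carrier ?G" using assms by (auto simp: hom_group_def Hom_def)
  ultimately show ?thesis by (simp add: D)
qed

lemmas preadd_simps = add_simps comp_zero zero_comp comp_diff diff_comp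
  diff_add_cancel add_diff_cancel diff_diff_cancel
  add_right_zero add_left_zero diff_right_zero diff_same

lemma monoI:
  assumes "f \<in> Ar C"
    and "\<And>X x. \<lbrakk>x \<in> Hom C X (Dom C f); f \<cdot> x = Zero C X (Cod C f)\<rbrakk> \<Longrightarrow> x = Zero C X (Dom C f)"
  shows "is_mono C f"
  unfolding is_mono_def
proof (intro conjI allI ballI impI)
  fix X g h assume a: "g \<in> Hom C X (Dom C f)" "h \<in> Hom C X (Dom C f)" "f \<cdot> g = f \<cdot> h"
  have "g \<boxminus> h = Zero C X (Dom C f)"
    using a assms(1) by (intro assms(2)) (auto simp: preadd_simps)
  then show "g = h" using a assms(1) diff_eq_zero[of g h] by (auto simp: Hom_def)
qed fact

lemma epiI:
  assumes "f \<in> Ar C"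
    and "\<And>Y y. \<lbrakk>y \<in> Hom C (Cod C f) Y; y \<cdot> f = Zero C (Dom C f) Y\<rbrakk> \<Longrightarrow> y = Zero C (Cod C f) Y"
  shows "is_epi C f"
  unfolding is_epi_def
proof (intro conjI allI ballI impI)
  fix Y g h assume a: "g \<in> Hom C (Cod C f) Y" "h \<in> Hom C (Cod C f) Y" "g \<cdot> f = h \<cdot> f"
  have "g \<boxminus> h = Zero C (Cod C f) Y"
    using a assms(1) by (intro assms(2)) (auto simp: preadd_simps)
  then show "g = h" using a assms(1) diff_eq_zero[of g h] by (auto simp: Hom_def)
qed fact

lemma monoD:
  assumes "is_mono C f" "x \<in> Hom C X (Dom C f)" "f \<cdot> x = Zero C X (Cod C f)"
  shows "x = Zero C X (Dom C f)"
proof -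
  have f: "f \<in> Ar C" using assms(1) by (simp add: is_mono_def)
  show ?thesis
    by (rule mono_cancel[OF assms(1) _ assms(2)]) (use f assms in \<open>auto simp: preadd_simps\<close>)
qed

lemma epiD:
  assumes "is_epi C f" "y \<in> Hom C (Cod C f) Y" "y \<cdot> f = Zero C (Dom C f) Y"
  shows "y = Zero C (Cod C f) Y"
proof -
  have f: "f \<in> Ar C" using assms(1) by (simp add: is_epi_def)
  show ?thesis
    by (rule epi_cancel[OF assms(1) _ assms(2)]) (use f assms in \<open>auto simp: preadd_simps\<close>)
qed

end

section \<open>Kernels, cokernels and direct sums\<close>

context preadditive_category
begin

lemma is_kernelD:
  assumes "is_kernel C f k"
  shows "f \<in> Ar C" "k \<in> Ar C" "Cod C k = Dom C f" "f \<cdot> k = Zero C (Dom C k) (Cod C f)"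
  using assms by (auto simp: is_kernel_def)

lemma is_cokernelD:
  assumes "is_cokernel C f c"
  shows "f \<in> Ar C" "c \<in> Ar C" "Dom C c = Cod C f" "c \<cdot> f = Zero C (Dom C f) (Cod C c)"
  using assms by (auto simp: is_cokernel_def)

lemma kernel_lift:
  assumes "is_kernel C f k" "x \<in> Hom C X (Dom C f)" "f \<cdot> x = Zero C X (Cod C f)"
  obtains u where "u \<in> Hom C X (Dom C k)" "k \<cdot> u = x"
  using assms unfolding is_kernel_def by blast

lemma cokernel_desc:
  assumes "is_cokernel C f c" "y \<in> Hom C (Cod C f) Y" "y \<cdot> f = Zero C (Dom C f) Y"
  obtains u where "u \<in> Hom C (Cod C c) Y" "u \<cdot> c = y"
  using assms unfolding is_cokernel_def by blast

lemma kernel_mono: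
  assumes "is_kernel C f k"
  shows "is_mono C k"
  unfolding is_mono_def
proof (intro conjI allI ballI impI)
  note K = is_kernelD[OF assms]
  show "k \<in> Ar C" by fact
  fix X g h assume a: "g \<in> Hom C X (Dom C k)" "h \<in> Hom C X (Dom C k)" "k \<cdot> g = k \<cdot> h"
  have "f \<cdot> (k \<cdot> h) = Zero C X (Cod C f)" "k \<cdot> h \<in> Hom C X (Dom C f)"
    using a K comp_reassoc[of k f _ h] by (auto simp: preadd_simps)
  then have "\<exists>!u. u \<in> Hom C X (Dom C k) \<and> k \<cdot> u = k \<cdot> h"
    using assms unfolding is_kernel_def by blast
  then show "g = h" using a by blast
qed

lemma cokernel_epi:
  assumes "is_cokernel C f c"
  shows "is_epi C c"
  unfolding is_epi_def
proof (intro conjI allI ballI impI)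
  note K = is_cokernelD[OF assms]
  show "c \<in> Ar C" by fact
  fix Y g h assume a: "g \<in> Hom C (Cod C c) Y" "h \<in> Hom C (Cod C c) Y" "g \<cdot> c = h \<cdot> c"
  have "(h \<cdot> c) \<cdot> f = Zero C (Dom C f) Y" "h \<cdot> c \<in> Hom C (Cod C f) Y"
    using a K by (auto simp: preadd_simps)
  then have "\<exists>!u. u \<in> Hom C (Cod C c) Y \<and> u \<cdot> c = h \<cdot> c"
    using assms unfolding is_cokernel_def by blast
  then show "g = h" using a by blast
qed

lemma direct_sumD:
  assumes "is_direct_sum C X Y S i1 i2 p1 p2"
  shows "X \<in> Ob C" "Y \<in> Ob C" "S \<in> Ob C" "i1 \<in> Ar C" "i2 \<in> Ar C" "p1 \<in> Ar C" "p2 \<in> Ar C"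
    "Dom C i1 = X" "Cod C i1 = S" "Dom C i2 = Y" "Cod C i2 = S"
    "Dom C p1 = S" "Cod C p1 = X" "Dom C p2 = S" "Cod C p2 = Y"
    "p1 \<cdot> i1 = Id C X" "p2 \<cdot> i2 = Id C Y" "p1 \<cdot> i2 = Zero C Y X" "p2 \<cdot> i1 = Zero C X Y"
    "(i1 \<cdot> p1) \<boxplus> (i2 \<cdot> p2) = Id C S"
  using assms by (auto simp: is_direct_sum_def Hom_def)

lemma direct_sum_cancel:
  assumes "is_direct_sum C X Y S i1 i2 p1 p2" "x \<in> Ar C"
  shows "Cod C x = X \<Longrightarrow> p1 \<cdot> (i1 \<cdot> x) = x" "Cod C x = Y \<Longrightarrow> p2 \<cdot> (i2 \<cdot> x) = x"
    "Cod C x = Y \<Longrightarrow> p1 \<cdot> (i2 \<cdot> x) = Zero C (Dom C x) X"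
    "Cod C x = X \<Longrightarrow> p2 \<cdot> (i1 \<cdot> x) = Zero C (Dom C x) Y"
  using assms(2) direct_sumD[OF assms(1)] comp_reassoc[of i1 p1 _ x] comp_reassoc[of i2 p2 _ x]
    comp_reassoc[of i2 p1 _ x] comp_reassoc[of i1 p2 _ x]
  by (simp_all add: preadd_simps)

lemma direct_sum_decompose:
  assumes "is_direct_sum C X Y S i1 i2 p1 p2" "x \<in> Ar C" "Cod C x = S"
  shows "(i1 \<cdot> (p1 \<cdot> x)) \<boxplus> (i2 \<cdot> (p2 \<cdot> x)) = x"
proof -
  note D = direct_sumD[OF assms(1)]
  have "((i1 \<cdot> p1) \<boxplus> (i2 \<cdot> p2)) \<cdot> x = x" unfolding D using assms(2,3) by (simp add: cat_simps)
  then show ?thesis using D(4-15) assms(2,3) by (simp add: preadd_simps)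
qed

end

context abelian_category
begin

lemma ker_mor_is_kernel: "f \<in> Ar C \<Longrightarrow> is_kernel C f (ker_mor C f)"
  unfolding ker_mor_def by (rule someI_ex) (rule ex_kernel)

lemma coker_mor_is_cokernel: "f \<in> Ar C \<Longrightarrow> is_cokernel C f (coker_mor C f)"
  unfolding coker_mor_def by (rule someI_ex) (rule ex_cokernel)

lemma mono_kernel_of_cokernel:
  assumes m: "is_mono C m" and c: "is_cokernel C m c"
  shows "is_kernel C c m"
proof -
  note K = is_cokernelD[OF c]
  obtain f where f: "is_kernel C f m" using mono_is_kernel[OF m] by blast
  note F = is_kernelD[OF f]
  obtain f' where f': "f' \<in> Hom C (Cod C c) (Cod C f)" "f' \<cdot> c = f"
    using cokernel_desc[OF c, of f "Cod C f"] F by (auto simp: Hom_def)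
  show ?thesis unfolding is_kernel_def
  proof (intro conjI allI ballI impI)
    fix X x assume x: "x \<in> Hom C X (Dom C c)" "c \<cdot> x = Zero C X (Cod C c)"
    have "f \<cdot> x = f' \<cdot> (c \<cdot> x)" using f' x K by (auto simp: Hom_def comp_assoc_Ar)
    also have "\<dots> = Zero C X (Cod C f)" unfolding x using f' x K by (auto simp: preadd_simps)
    finally obtain u where u: "u \<in> Hom C X (Dom C m)" "m \<cdot> u = x"
      using kernel_lift[OF f, of x X] x K F by auto
    then show "\<exists>!u. u \<in> Hom C X (Dom C m) \<and> m \<cdot> u = x"
      using mono_cancel[OF m] by blast
  qed (use K in auto)
qed

lemma epi_cokernel_of_kernel:
  assumes e: "is_epi C e" and k: "is_kernel C e k"
  shows "is_cokernel C k e"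
proof -
  note K = is_kernelD[OF k]
  obtain f where f: "is_cokernel C f e" using epi_is_cokernel[OF e] by blast
  note F = is_cokernelD[OF f]
  obtain f' where f': "f' \<in> Hom C (Dom C f) (Dom C k)" "k \<cdot> f' = f"
    using kernel_lift[OF k, of f "Dom C f"] F by (auto simp: Hom_def)
  show ?thesis unfolding is_cokernel_def
  proof (intro conjI allI ballI impI)
    fix Y y assume y: "y \<in> Hom C (Cod C k) Y" "y \<cdot> k = Zero C (Dom C k) Y"
    have "y \<cdot> f = (y \<cdot> k) \<cdot> f'"
      unfolding f'(2)[symmetric] using f'(1) y(1) K(1-3) by (auto simp: cat_simps)
    also have "\<dots> = Zero C (Dom C f) Y"
      unfolding y(2) using f'(1) y(1) K(1-3) F(1) by (auto simp: preadd_simps)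
    finally obtain u where u: "u \<in> Hom C (Cod C e) Y" "u \<cdot> e = y"
      using cokernel_desc[OF f, of y Y] y K F by auto
    then show "\<exists>!u. u \<in> Hom C (Cod C e) Y \<and> u \<cdot> e = y"
      using epi_cancel[OF e] by blast
  qed (use K in auto)
qed

text \<open>A monomorphism is the kernel of its cokernel, so lying in a subobject can be tested on
  the arrows that vanish on it.\<close>

lemma factors_through_mono:
  assumes m: "is_mono C m" and x: "x \<in> Hom C X (Cod C m)"
    and ann: "\<And>Y y. \<lbrakk>y \<in> Hom C (Cod C m) Y; y \<cdot> m = Zero C (Dom C m) Y\<rbrakk> \<Longrightarrow> y \<cdot> x = Zero C X Y"
  obtains u where "u \<in> Hom C X (Dom C m)" "m \<cdot> u = x"
proof -
  have mA: "m \<in> Ar C" using m by (simp add: is_mono_def)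
  note c = coker_mor_is_cokernel[OF mA]
  note K = is_cokernelD[OF c]
  have "coker_mor C m \<cdot> x = Zero C X (Cod C (coker_mor C m))"
    using K by (intro ann) (auto simp: Hom_def)
  then show ?thesis
    using kernel_lift[OF mono_kernel_of_cokernel[OF m c], of x X] x K that by auto
qed

lemma img_incl_kernel:
  "f \<in> Ar C \<Longrightarrow> is_kernel C (coker_mor C f) (img_incl C f)"
  unfolding img_incl_def
  using ker_mor_is_kernel is_cokernelD(2)[OF coker_mor_is_cokernel] by blast

lemma img_incl_props:
  assumes "f \<in> Ar C"
  shows "is_mono C (img_incl C f)" "img_incl C f \<in> Hom C (Img C f) (Cod C f)"
  using kernel_mono[OF img_incl_kernel[OF assms]] is_kernelD[OF img_incl_kernel[OF assms]]
    is_cokernelD[OF coker_mor_is_cokernel[OF assms]]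
  by (auto simp: Img_def Hom_def)

lemma factors_through_image_iff:
  assumes f: "f \<in> Ar C" and e: "e \<in> Hom C X (Cod C f)"
  shows "(\<exists>u \<in> Hom C X (Img C f). img_incl C f \<cdot> u = e) \<longleftrightarrow>
    (\<forall>Y. \<forall>y \<in> Hom C (Cod C f) Y. y \<cdot> f = Zero C (Dom C f) Y \<longrightarrow> y \<cdot> e = Zero C X Y)"
    (is "?L \<longleftrightarrow> ?R")
proof
  note c = coker_mor_is_cokernel[OF f] and j = img_incl_kernel[OF f]
  note K = is_cokernelD[OF c] and J = is_kernelD[OF j]
  show ?R if ?L
  proof (intro allI ballI impI)
    fix Y y assume y: "y \<in> Hom C (Cod C f) Y" "y \<cdot> f = Zero C (Dom C f) Y"
    obtain u where u: "u \<in> Hom C X (Img C f)" "img_incl C f \<cdot> u = e"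
      using \<open>?L\<close> by blast
    obtain y' where y': "y' \<in> Hom C (Cod C (coker_mor C f)) Y" "y' \<cdot> coker_mor C f = y"
      using cokernel_desc[OF c y] .
    have "y \<cdot> e = y' \<cdot> ((coker_mor C f \<cdot> img_incl C f) \<cdot> u)"
      unfolding u(2)[symmetric] y'(2)[symmetric] using u(1) y'(1) K(2,3) J(2,3)
      by (auto simp: cat_simps Img_def)
    also have "\<dots> = Zero C X Y" unfolding J(4) using u(1) y'(1) K(2,3) J(2,3)
      by (auto simp: preadd_simps Img_def)
    finally show "y \<cdot> e = Zero C X Y" .
  qed
  show ?L if ?R
  proof -
    have "coker_mor C f \<cdot> e = Zero C X (Cod C (coker_mor C f))"
      using that K by (auto simp: Hom_def)
    then show ?L using kernel_lift[OF j, of e X] e K by (auto simp: Img_def)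
  qed
qed

lemma img_proj_props:
  assumes f: "f \<in> Ar C"
  shows "img_proj C f \<in> Hom C (Dom C f) (Img C f)" "img_incl C f \<cdot> img_proj C f = f"
proof -
  have "\<exists>u \<in> Hom C (Dom C f) (Img C f). img_incl C f \<cdot> u = f"
    using factors_through_image_iff[OF f, of f "Dom C f"] f by (auto simp: Hom_def)
  then have "\<exists>!u. u \<in> Hom C (Dom C f) (Img C f) \<and> img_incl C f \<cdot> u = f"
    using mono_cancel[OF img_incl_props(1)[OF f]] by (auto simp: Img_def)
  then show "img_proj C f \<in> Hom C (Dom C f) (Img C f)" "img_incl C f \<cdot> img_proj C f = f"
    using theI'[of "\<lambda>p. p \<in> Hom C (Dom C f) (Img C f) \<and> img_incl C f \<cdot> p = f"]
    unfolding img_proj_def by auto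
qed

text \<open>Let \<open>j\<close> be a monomorphism such that every arrow vanishing on \<open>j \<cdot> p\<close> vanishes on \<open>j\<close>.
  If \<open>z \<cdot> p = 0\<close>, then \<open>j \<cdot> p\<close> lies in the subobject \<open>j \<cdot> ker z\<close>; hence so does \<open>j\<close>,
  which makes \<open>ker z\<close> the whole domain of \<open>z\<close>.\<close>

lemma epi_if_annihilators_agree:
  assumes j: "is_mono C j" and p: "p \<in> Ar C" "Cod C p = Dom C j"
    and ann: "\<And>Y y. \<lbrakk>y \<in> Hom C (Cod C j) Y; y \<cdot> (j \<cdot> p) = Zero C (Dom C p) Y\<rbrakk>
      \<Longrightarrow> y \<cdot> j = Zero C (Dom C j) Y"
  shows "is_epi C p"
proof (rule epiI)
  fix Z z assume z: "z \<in> Hom C (Cod C p) Z" "z \<cdot> p = Zero C (Dom C p) Z"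
  have jA: "j \<in> Ar C" using j by (simp add: is_mono_def)
  define i where "i = ker_mor C z"
  have zA: "z \<in> Ar C" "Dom C z = Dom C j" "Cod C z = Z" using z p by (auto simp: Hom_def)
  have ik: "is_kernel C z i" unfolding i_def using ker_mor_is_kernel[OF zA(1)] .
  note I = is_kernelD[OF ik]
  obtain l where l: "l \<in> Hom C (Dom C p) (Dom C i)" "i \<cdot> l = p"
    using kernel_lift[OF ik, of p "Dom C p"] z p zA by (auto simp: Hom_def)
  have ji: "is_mono C (j \<cdot> i)"
  proof (rule monoI)
    show "j \<cdot> i \<in> Ar C" using jA I zA by (simp add: cat_simps)
    fix X x assume x: "x \<in> Hom C X (Dom C (j \<cdot> i))" "(j \<cdot> i) \<cdot> x = Zero C X (Cod C (j \<cdot> i))"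
    have "i \<cdot> x = Zero C X (Dom C j)"
      by (rule monoD[OF j]) (use x jA I zA in \<open>auto simp: preadd_simps\<close>)
    then have "x = Zero C X (Dom C i)"
      by (intro monoD[OF kernel_mono[OF ik]]) (use x jA I zA in \<open>auto simp: preadd_simps\<close>)
    then show "x = Zero C X (Dom C (j \<cdot> i))" using jA I zA by (auto simp: preadd_simps)
  qed
  obtain t where t: "t \<in> Hom C (Dom C j) (Dom C (j \<cdot> i))" "(j \<cdot> i) \<cdot> t = j"
  proof (rule factors_through_mono[OF ji, of j "Dom C j"])
    show "j \<in> Hom C (Dom C j) (Cod C (j \<cdot> i))" using jA I zA by (auto simp: preadd_simps)
    fix Y y assume y: "y \<in> Hom C (Cod C (j \<cdot> i)) Y" "y \<cdot> (j \<cdot> i) = Zero C (Dom C (j \<cdot> i)) Y"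
    have "y \<cdot> (j \<cdot> p) = (y \<cdot> (j \<cdot> i)) \<cdot> l" unfolding l(2)[symmetric]
      using y(1) l(1) jA I zA by (auto simp: preadd_simps)
    also have "\<dots> = Zero C (Dom C p) Y"
      unfolding y(2) using y(1) l(1) jA I zA by (auto simp: preadd_simps)
    finally show "y \<cdot> j = Zero C (Dom C j) Y"
      using y(1) jA I zA by (intro ann) (auto simp: preadd_simps)
  qed
  have it: "i \<cdot> t = Id C (Dom C j)"
    by (rule mono_cancel[OF j, of _ _ "Dom C j"])
      (use t jA I zA in \<open>auto simp: preadd_simps\<close>)
  have "z = (z \<cdot> i) \<cdot> t" using it t jA I(1-3) zA by (auto simp: preadd_simps)
  also have "\<dots> = Zero C (Cod C p) Z" unfolding I(4) using t jA I(1-3) zA p by (auto simp: preadd_simps)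
  finally show "z = Zero C (Cod C p) Z" .
qed fact

lemma img_proj_epi:
  assumes f: "f \<in> Ar C"
  shows "is_epi C (img_proj C f)"
proof (rule epi_if_annihilators_agree[OF img_incl_props(1)[OF f]])
  note J = img_incl_props(2)[OF f] and P = img_proj_props[OF f]
  show "img_proj C f \<in> Ar C" "Cod C (img_proj C f) = Dom C (img_incl C f)"
    using J P by (auto simp: Hom_def)
  have "\<exists>u \<in> Hom C (Img C f) (Img C f). img_incl C f \<cdot> u = img_incl C f"
    using J dom_in_Ob[of "img_incl C f"]
    by (intro bexI[of _ "Id C (Img C f)"]) (auto simp: cat_simps)
  then show "y \<cdot> img_incl C f = Zero C (Dom C (img_incl C f)) Y"
    if "y \<in> Hom C (Cod C (img_incl C f)) Y"
      "y \<cdot> (img_incl C f \<cdot> img_proj C f) = Zero C (Dom C (img_proj C f)) Y" for Y y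
    using factors_through_image_iff[OF f J] that J P by (auto simp: Hom_def)
qed

end

section \<open>Extensions within the image\<close>

text \<open>The image of \<open>h \<cdot> \<mu>\<close> is the kernel of its cokernel, hence an arrow takes its values in it
  if and only if it is killed by every arrow killing \<open>h \<cdot> \<mu>\<close>. In this form \<open>\<mu>\<close> can be replaced
  without comparing image objects.\<close>

definition extends_within_image :: "('o, 'm, 'x) abcat_scheme \<Rightarrow> 'm \<Rightarrow> 'm \<Rightarrow> bool" where
  "extends_within_image C \<mu> h \<longleftrightarrow>
     (\<exists>e \<in> Hom C (Cod C \<mu>) (Cod C h). e \<cdot>\<^bsub>C\<^esub> \<mu> = h \<cdot>\<^bsub>C\<^esub> \<mu> \<and>
       (\<forall>Y. \<forall>y \<in> Hom C (Cod C h) Y. y \<cdot>\<^bsub>C\<^esub> (h \<cdot>\<^bsub>C\<^esub> \<mu>) = Zero C (Dom C \<mu>) Y \<longrightarrow>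
          y \<cdot>\<^bsub>C\<^esub> e = Zero C (Cod C \<mu>) Y))"

context abelian_category
begin

lemma coincides_within_image_iff:
  assumes \<mu>: "\<mu> \<in> Hom C K M" and h: "h \<in> Hom C M T"
  shows "(\<exists>h' \<in> Hom C M (Img C (h \<cdot> \<mu>)). img_incl C (h \<cdot> \<mu>) \<cdot> h' \<cdot> \<mu> = h \<cdot> \<mu>)
    \<longleftrightarrow> extends_within_image C \<mu> h"
    (is "?L \<longleftrightarrow> _")
proof -
  have hm: "h \<cdot> \<mu> \<in> Ar C" "Cod C (h \<cdot> \<mu>) = T" "Dom C (h \<cdot> \<mu>) = K"
    using \<mu> h by (auto simp: cat_simps)
  have ends: "Cod C \<mu> = M" "Dom C \<mu> = K" "Cod C h = T" using \<mu> h by (auto simp: Hom_def)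
  note J = img_incl_props(2)[OF hm(1)]
  have assoc: "img_incl C (h \<cdot> \<mu>) \<cdot> h' \<cdot> \<mu> = (img_incl C (h \<cdot> \<mu>) \<cdot> h') \<cdot> \<mu>"
    if "h' \<in> Hom C M (Img C (h \<cdot> \<mu>))" for h'
    using that J \<mu> by (auto simp: cat_simps)
  have "?L \<longleftrightarrow> (\<exists>e \<in> Hom C M T. e \<cdot> \<mu> = h \<cdot> \<mu> \<and>
      (\<exists>h' \<in> Hom C M (Img C (h \<cdot> \<mu>)). img_incl C (h \<cdot> \<mu>) \<cdot> h' = e))"
    using assoc comp_in_Hom[OF _ J] hm by (metis (no_types, lifting))
  also have "\<dots> \<longleftrightarrow> extends_within_image C \<mu> h"
    unfolding extends_within_image_def ends
    by (intro bex_cong refl conj_cong factors_through_image_iff[OF hm(1), of _ M, unfolded hm(2,3)])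
  finally show ?thesis .
qed

lemma img_proj_factors_iff:
  assumes \<mu>: "\<mu> \<in> Hom C K M" and h: "h \<in> Hom C M T"
  shows "(\<exists>q \<in> Hom C M (Img C (h \<cdot> \<mu>)). img_proj C (h \<cdot> \<mu>) = q \<cdot> \<mu>)
    \<longleftrightarrow> extends_within_image C \<mu> h"
proof -
  have hm: "h \<cdot> \<mu> \<in> Ar C" "Cod C (h \<cdot> \<mu>) = T" "Dom C (h \<cdot> \<mu>) = K"
    using \<mu> h by (auto simp: cat_simps)
  note J = img_incl_props[OF hm(1)] and P = img_proj_props[OF hm(1)]
  have "img_proj C (h \<cdot> \<mu>) = q \<cdot> \<mu> \<longleftrightarrow> img_incl C (h \<cdot> \<mu>) \<cdot> q \<cdot> \<mu> = h \<cdot> \<mu>"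
    if q: "q \<in> Hom C M (Img C (h \<cdot> \<mu>))" for q
  proof -
    have "q \<cdot> \<mu> \<in> Hom C K (Dom C (img_incl C (h \<cdot> \<mu>)))"
      "img_proj C (h \<cdot> \<mu>) \<in> Hom C K (Dom C (img_incl C (h \<cdot> \<mu>)))"
      using q \<mu> J(2) P hm by (auto simp: cat_simps)
    then show ?thesis using mono_cancel[OF J(1)] P(2) by metis
  qed
  then show ?thesis using coincides_within_image_iff[OF \<mu> h] by blast
qed

lemma kernels_factor:
  assumes "is_kernel C f k" "is_kernel C f k'"
  obtains u where "u \<in> Hom C (Dom C k') (Dom C k)" "k \<cdot> u = k'"
  using kernel_lift[OF assms(1), of k' "Dom C k'"] is_kernelD[OF assms(2)] that
  by (auto simp: Hom_def)

text \<open>The operation \<open>ker_mor\<close> picks one kernel of an arrow; this transfers the property to any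
  other one.\<close>

lemma extends_within_image_kernel_cong:
  assumes k: "is_kernel C f k" and k': "is_kernel C f k'"
    and h: "h \<in> Hom C (Dom C f) T" and ext: "extends_within_image C k h"
  shows "extends_within_image C k' h"
proof -
  note K = is_kernelD[OF k] and K' = is_kernelD[OF k']
  obtain u where u: "u \<in> Hom C (Dom C k') (Dom C k)" "k \<cdot> u = k'" by (rule kernels_factor[OF k k'])
  obtain v where v: "v \<in> Hom C (Dom C k) (Dom C k')" "k' \<cdot> v = k" by (rule kernels_factor[OF k' k])
  obtain e where e: "e \<in> Hom C (Cod C k) (Cod C h)" "e \<cdot> k = h \<cdot> k"
    and ann: "\<And>Y y. \<lbrakk>y \<in> Hom C (Cod C h) Y; y \<cdot> (h \<cdot> k) = Zero C (Dom C k) Y\<rbrakk>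
      \<Longrightarrow> y \<cdot> e = Zero C (Cod C k) Y"
    using ext unfolding extends_within_image_def by blast
  have "e \<cdot> k' = (e \<cdot> k) \<cdot> u"
    unfolding u(2)[symmetric] using e(1) u(1) K by (auto simp: cat_simps)
  also have "\<dots> = h \<cdot> k'"
    unfolding u(2)[symmetric] e(2) using h u(1) K by (auto simp: cat_simps)
  finally have "e \<cdot> k' = h \<cdot> k'" .
  moreover have "y \<cdot> e = Zero C (Cod C k') Y"
    if y: "y \<in> Hom C (Cod C h) Y" "y \<cdot> (h \<cdot> k') = Zero C (Dom C k') Y" for Y y
  proof -
    have "y \<cdot> (h \<cdot> k) = (y \<cdot> (h \<cdot> k')) \<cdot> v"
      unfolding v(2)[symmetric] using y(1) v(1) h K' by (auto simp: cat_simps)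
    also have "\<dots> = Zero C (Dom C k) Y"
      unfolding y(2) using y(1) v(1) h K' by (auto simp: preadd_simps)
    finally show ?thesis using ann[OF y(1)] K K' by simp
  qed
  ultimately show ?thesis using e(1) K K' unfolding extends_within_image_def by auto
qed

text \<open>A retraction \<open>r\<close> of \<open>k\<close> and a section \<open>s\<close> of \<open>f\<close> determine each other by
  \<open>k \<cdot> r + s \<cdot> f = 1\<close>.\<close>

lemma section_iff_retraction:
  assumes f: "is_epi C f" and k: "is_kernel C f k"
  shows "is_section C k \<longleftrightarrow> is_retraction C f"
proof
  note K = is_kernelD[OF k]
  have ob: "Dom C f \<in> Ob C" "Cod C f \<in> Ob C" "Dom C k \<in> Ob C" using K by (auto simp: cat_simps)
  note c = epi_cokernel_of_kernel[OF f k]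
  show "is_retraction C f" if "is_section C k"
  proof -
    obtain r where r: "r \<in> Hom C (Dom C f) (Dom C k)" "r \<cdot> k = Id C (Dom C k)"
      using \<open>is_section C k\<close> K unfolding is_section_def by auto
    have "(Id C (Dom C f) \<boxminus> k \<cdot> r) \<cdot> k = Zero C (Dom C k) (Dom C f)"
      "Id C (Dom C f) \<boxminus> k \<cdot> r \<in> Hom C (Cod C k) (Dom C f)"
      using r K ob by (auto simp: preadd_simps)
    then obtain s where s: "s \<in> Hom C (Cod C f) (Dom C f)" "s \<cdot> f = Id C (Dom C f) \<boxminus> k \<cdot> r"
      using cokernel_desc[OF c] by blast
    have "f \<cdot> (s \<cdot> f) = f"
      unfolding s(2) using r(1) K ob comp_reassoc[of k f _ r] by (auto simp: preadd_simps)
    then have "f \<cdot> s = Id C (Cod C f)"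
      using epi_cancel[OF f, of "f \<cdot> s" "Id C (Cod C f)" "Cod C f"] s(1) K ob
      by (auto simp: cat_simps)
    then show ?thesis using s K unfolding is_retraction_def by auto
  qed
  show "is_section C k" if "is_retraction C f"
  proof -
    obtain s where s: "s \<in> Hom C (Cod C f) (Dom C f)" "f \<cdot> s = Id C (Cod C f)"
      using \<open>is_retraction C f\<close> K unfolding is_retraction_def by auto
    have "f \<cdot> (s \<cdot> f) = (f \<cdot> s) \<cdot> f" using s(1) K by (auto simp: cat_simps)
    then have "f \<cdot> (s \<cdot> f) = f" unfolding s(2) using K by (simp add: cat_simps)
    then have "f \<cdot> (Id C (Dom C f) \<boxminus> s \<cdot> f) = Zero C (Dom C f) (Cod C f)"
      "Id C (Dom C f) \<boxminus> s \<cdot> f \<in> Hom C (Dom C f) (Dom C f)"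
      using s(1) K ob by (auto simp: preadd_simps)
    then obtain r where r: "r \<in> Hom C (Dom C f) (Dom C k)" "k \<cdot> r = Id C (Dom C f) \<boxminus> s \<cdot> f"
      using kernel_lift[OF k] by blast
    have "(k \<cdot> r) \<cdot> k = k"
      unfolding r(2) using s(1) K ob by (auto simp: preadd_simps)
    then have "r \<cdot> k = Id C (Dom C k)"
      using mono_cancel[OF kernel_mono[OF k], of "r \<cdot> k" "Id C (Dom C k)" "Dom C k"] r(1) K ob
      by (auto simp: cat_simps)
    then show ?thesis using r K unfolding is_section_def by auto
  qed
qed

lemma img_incl_proper_iff:
  assumes m: "m \<in> Ar C"
  shows "proper_subobject C (img_incl C m) \<longleftrightarrow> \<not> is_epi C m"
proof -
  note J = img_incl_props[OF m] and P = img_proj_props[OF m]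
  have "is_iso C (img_incl C m) \<longleftrightarrow> is_epi C m"
  proof
    assume "is_iso C (img_incl C m)"
    then obtain t where t: "t \<in> Hom C (Cod C m) (Img C m)" "img_incl C m \<cdot> t = Id C (Cod C m)"
      using J unfolding is_iso_def by (auto simp: Hom_def)
    show "is_epi C m"
    proof (rule epiI[OF m])
      fix Y y assume y: "y \<in> Hom C (Cod C m) Y" "y \<cdot> m = Zero C (Dom C m) Y"
      have "\<exists>u \<in> Hom C (Cod C m) (Img C m). img_incl C m \<cdot> u = Id C (Cod C m)"
        using t by blast
      then have "y \<cdot> Id C (Cod C m) = Zero C (Cod C m) Y"
        using factors_through_image_iff[OF m id_in_Hom[of "Cod C m"]] y m by (auto simp: cat_simps)
      then show "y = Zero C (Cod C m) Y" using y by (auto simp: cat_simps)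
    qed
  next
    assume e: "is_epi C m"
    have "\<exists>u \<in> Hom C (Cod C m) (Img C m). img_incl C m \<cdot> u = Id C (Cod C m)"
      using factors_through_image_iff[OF m id_in_Hom[of "Cod C m"]] epiD[OF e] m
      by (auto simp: preadd_simps)
    then obtain u where u: "u \<in> Hom C (Cod C m) (Img C m)" "img_incl C m \<cdot> u = Id C (Cod C m)"
      by blast
    have ob: "Img C m \<in> Ob C" "Cod C m \<in> Ob C" using J(2) m dom_in_Ob[of "img_incl C m"] by (auto simp: cat_simps)
    have "u \<cdot> img_incl C m = Id C (Img C m)"
    proof (rule mono_cancel[OF J(1), of _ _ "Img C m"])
      have "img_incl C m \<cdot> (u \<cdot> img_incl C m) = (img_incl C m \<cdot> u) \<cdot> img_incl C m"
        using J(2) u(1) by (auto simp: cat_simps)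
      then show "img_incl C m \<cdot> (u \<cdot> img_incl C m) = img_incl C m \<cdot> Id C (Img C m)"
        unfolding u(2) using J(2) by (auto simp: cat_simps)
    qed (use J(2) u(1) ob in \<open>auto simp: cat_simps\<close>)
    then show "is_iso C (img_incl C m)"
      using u J(2) unfolding is_iso_def by (auto simp: Hom_def)
  qed
  then show ?thesis using J(1) unfolding proper_subobject_def by blast
qed

lemma subobject_sum_proper_iff:
  assumes u: "u \<in> Hom C U M" and v: "v \<in> Hom C V M"
  shows "\<not> proper_subobject C (subobject_sum C u v) \<longleftrightarrow>
    (\<forall>Y. \<forall>y \<in> Hom C M Y. y \<cdot> u = Zero C U Y \<and> y \<cdot> v = Zero C V Y \<longrightarrow> y = Zero C M Y)"
proof -
  have uv: "Dom C u = U" "Dom C v = V" "u \<in> Ar C" "v \<in> Ar C" "Cod C u = M" "Cod C v = M"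
    "U \<in> Ob C" "V \<in> Ob C" "M \<in> Ob C"
    using u v by (auto simp: cat_simps)
  have "\<exists>s S i\<^sub>1 i\<^sub>2 p\<^sub>1 p\<^sub>2. is_direct_sum C (Dom C u) (Dom C v) S i\<^sub>1 i\<^sub>2 p\<^sub>1 p\<^sub>2 \<and>
     s = img_incl C ((u \<cdot> p\<^sub>1) \<boxplus> (v \<cdot> p\<^sub>2))"
    using ex_direct_sum[of U V] uv by auto
  from someI_ex[OF this, folded subobject_sum_def] obtain S i1 i2 p1 p2 where
    D: "is_direct_sum C U V S i1 i2 p1 p2"
    and s: "subobject_sum C u v = img_incl C ((u \<cdot> p1) \<boxplus> (v \<cdot> p2))"
    unfolding uv by blast
  note DD = direct_sumD[OF D]
  let ?m = "(u \<cdot> p1) \<boxplus> (v \<cdot> p2)"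
  have m: "?m \<in> Ar C" "Dom C ?m = S" "Cod C ?m = M" using DD uv by (auto simp: preadd_simps)
  have mi: "?m \<cdot> i1 = u" "?m \<cdot> i2 = v" using DD uv by (auto simp: preadd_simps)
  have key: "y \<cdot> ?m = Zero C S Y \<longleftrightarrow> y \<cdot> u = Zero C U Y \<and> y \<cdot> v = Zero C V Y"
    if y: "y \<in> Hom C M Y" for y Y
  proof
    assume 0: "y \<cdot> ?m = Zero C S Y"
    have "y \<cdot> (?m \<cdot> i1) = (y \<cdot> ?m) \<cdot> i1" "y \<cdot> (?m \<cdot> i2) = (y \<cdot> ?m) \<cdot> i2"
      using y m DD comp_assoc_Ar by (auto simp: Hom_def)
    then show "y \<cdot> u = Zero C U Y \<and> y \<cdot> v = Zero C V Y"
      unfolding 0 mi using y DD by (auto simp: preadd_simps)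
  next
    assume "y \<cdot> u = Zero C U Y \<and> y \<cdot> v = Zero C V Y"
    then show "y \<cdot> ?m = Zero C S Y"
      using y DD uv comp_reassoc[of u y _ p1] comp_reassoc[of v y _ p2] by (auto simp: preadd_simps)
  qed
  have "\<not> proper_subobject C (subobject_sum C u v) \<longleftrightarrow> is_epi C ?m"
    unfolding s using img_incl_proper_iff[OF m(1)] by blast
  also have "\<dots> \<longleftrightarrow> (\<forall>Y. \<forall>y \<in> Hom C M Y. y \<cdot> ?m = Zero C S Y \<longrightarrow> y = Zero C M Y)"
    using epiI[OF m(1)] epiD[of ?m] m by metis
  finally show ?thesis using key by blast
qed

text \<open>For submodules this is the equivalence of \<open>K + ker e = M\<close> and \<open>e(K) = e(M)\<close>. Both sides
  are phrased by the arrows vanishing on a subobject. From right to left, factor \<open>e = j \<cdot> p\<close> through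
  its image; an arrow killing \<open>ker e\<close> has the form \<open>z \<cdot> p\<close>, and the hypothesis says that \<open>p \<cdot> k\<close>
  is an epimorphism, so \<open>z \<cdot> p \<cdot> k = 0\<close> forces \<open>z = 0\<close>.\<close>

lemma generates_modulo_kernel_iff:
  assumes k: "k \<in> Hom C K M" and e: "e \<in> Hom C M T"
  shows "(\<forall>Y. \<forall>y \<in> Hom C M Y. y \<cdot> k = Zero C K Y \<and>
        y \<cdot> ker_mor C e = Zero C (Dom C (ker_mor C e)) Y \<longrightarrow> y = Zero C M Y) \<longleftrightarrow>
    (\<forall>Y. \<forall>y \<in> Hom C T Y. y \<cdot> (e \<cdot> k) = Zero C K Y \<longrightarrow> y \<cdot> e = Zero C M Y)"
    (is "?A \<longleftrightarrow> ?B")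
proof
  let ?v = "ker_mor C e"
  have eA: "e \<in> Ar C" "Dom C e = M" "Cod C e = T" and kA: "k \<in> Ar C" "Dom C k = K" "Cod C k = M"
    using k e by (auto simp: Hom_def)
  note vk = ker_mor_is_kernel[OF eA(1)]
  note V = is_kernelD[OF vk]
  show ?B if A: ?A
  proof (intro allI ballI impI)
    fix Y y assume y: "y \<in> Hom C T Y" "y \<cdot> (e \<cdot> k) = Zero C K Y"
    have "(y \<cdot> e) \<cdot> k = Zero C K Y" "y \<cdot> e \<in> Hom C M Y"
      using y eA kA by (auto simp: cat_simps)
    moreover have "(y \<cdot> e) \<cdot> ?v = Zero C (Dom C ?v) Y"
      using y eA V by (auto simp: preadd_simps)
    ultimately show "y \<cdot> e = Zero C M Y" using A by blast
  qed
  show ?A if B: ?B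
  proof (intro allI ballI impI)
    fix Y y assume y: "y \<in> Hom C M Y"
      and yy: "y \<cdot> k = Zero C K Y \<and> y \<cdot> ?v = Zero C (Dom C ?v) Y"
    define j where "j = img_incl C e"
    define p where "p = img_proj C e"
    have j: "is_mono C j" "j \<in> Ar C" "Cod C j = T"
      and p: "is_epi C p" "p \<in> Ar C" "Dom C p = M" "Cod C p = Dom C j" and jp: "j \<cdot> p = e"
      using img_incl_props[OF eA(1)] img_proj_props[OF eA(1)] img_proj_epi[OF eA(1)] eA
      by (auto simp: Hom_def j_def p_def)
    note wk = ker_mor_is_kernel[OF p(2)]
    note W = is_kernelD[OF wk]
    let ?w = "ker_mor C p"
    have "e \<cdot> ?w = Zero C (Dom C ?w) T"
      unfolding jp[symmetric] using j p W by (auto simp: preadd_simps)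
    then obtain t where t: "t \<in> Hom C (Dom C ?w) (Dom C ?v)" "?v \<cdot> t = ?w"
      using kernel_lift[OF vk, of ?w "Dom C ?w"] W eA p by (auto simp: Hom_def)
    have "y \<cdot> ?w = (y \<cdot> ?v) \<cdot> t"
      unfolding t(2)[symmetric] using y t(1) V eA by (auto simp: cat_simps)
    also have "\<dots> = Zero C (Dom C ?w) Y"
      using yy t(1) y V eA by (auto simp: preadd_simps)
    finally obtain z where z: "z \<in> Hom C (Dom C j) Y" "z \<cdot> p = y"
      using cokernel_desc[OF epi_cokernel_of_kernel[OF p(1) wk], of y Y] y W p by auto
    have pk: "is_epi C (p \<cdot> k)"
    proof (rule epi_if_annihilators_agree[OF j(1)])
      show "p \<cdot> k \<in> Ar C" "Cod C (p \<cdot> k) = Dom C j" using p kA by (auto simp: cat_simps)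
      fix X x assume x: "x \<in> Hom C (Cod C j) X" "x \<cdot> (j \<cdot> (p \<cdot> k)) = Zero C (Dom C (p \<cdot> k)) X"
      have "j \<cdot> (p \<cdot> k) = e \<cdot> k" unfolding jp[symmetric] using j p kA by (auto simp: cat_simps)
      then have "x \<cdot> e = Zero C M X" using B x p kA j by (auto simp: cat_simps)
      then have "(x \<cdot> j) \<cdot> p = Zero C (Dom C p) X"
        unfolding jp[symmetric] using x(1) p j by (auto simp: cat_simps)
      then show "x \<cdot> j = Zero C (Dom C j) X"
        using epiD[OF p(1), of "x \<cdot> j" X] x(1) j p by (auto simp: cat_simps)
    qed
    have "z \<cdot> (p \<cdot> k) = Zero C K Y"
      using yy z p kA by (auto simp: cat_simps)
    then have "z = Zero C (Dom C j) Y"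
      using epiD[OF pk, of z Y] z p kA by (auto simp: cat_simps)
    moreover have "Y \<in> Ob C" using y by (auto simp: cat_simps)
    ultimately show "y = Zero C M Y" using z(2) p by (auto simp: preadd_simps)
  qed
qed

text \<open>Since \<open>f\<close> is the cokernel of its kernel, the arrows \<open>h - g \<cdot> f\<close> are exactly the arrows that
  agree with \<open>h\<close> on the kernel of \<open>f\<close>.\<close>

lemma sum_with_kernel_iff:
  assumes f: "is_epi C f" and h: "h \<in> Hom C (Dom C f) T"
  shows "(\<exists>g \<in> Hom C (Cod C f) T.
      \<not> proper_subobject C (subobject_sum C (ker_mor C f) (ker_mor C (h \<boxminus> g \<cdot> f)))) \<longleftrightarrow>
    extends_within_image C (ker_mor C f) h"
proof -
  let ?k = "ker_mor C f"
  have fA: "f \<in> Ar C" using f by (simp add: is_epi_def)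
  note kk = ker_mor_is_kernel[OF fA]
  note K = is_kernelD[OF kk]
  note c = epi_cokernel_of_kernel[OF f kk]
  define Q where "Q e \<longleftrightarrow> (\<forall>Y. \<forall>y \<in> Hom C T Y. y \<cdot> (e \<cdot> ?k) = Zero C (Dom C ?k) Y
    \<longrightarrow> y \<cdot> e = Zero C (Dom C f) Y)" for e
  have sum: "\<not> proper_subobject C (subobject_sum C ?k (ker_mor C e)) \<longleftrightarrow> Q e"
    if e: "e \<in> Hom C (Dom C f) T" for e
  proof -
    have k: "?k \<in> Hom C (Dom C ?k) (Dom C f)" using K by (simp add: Hom_def)
    have "ker_mor C e \<in> Hom C (Dom C (ker_mor C e)) (Dom C f)"
      using is_kernelD[OF ker_mor_is_kernel[of e]] e by (auto simp: Hom_def)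
    then show ?thesis
      using subobject_sum_proper_iff[OF k] generates_modulo_kernel_iff[OF k e]
      unfolding Q_def by simp
  qed
  have d: "h \<boxminus> g \<cdot> f \<in> Hom C (Dom C f) T" "(h \<boxminus> g \<cdot> f) \<cdot> ?k = h \<cdot> ?k"
    if "g \<in> Hom C (Cod C f) T" for g
    using that h K by (auto simp: preadd_simps)
  have "\<exists>g \<in> Hom C (Cod C f) T. e = h \<boxminus> g \<cdot> f"
    if e: "e \<in> Hom C (Dom C f) T" "e \<cdot> ?k = h \<cdot> ?k" for e
  proof -
    have "(h \<boxminus> e) \<cdot> ?k = Zero C (Dom C ?k) T" "h \<boxminus> e \<in> Hom C (Cod C ?k) T"
      using e h K by (auto simp: preadd_simps)
    then obtain g where g: "g \<in> Hom C (Cod C f) T" "g \<cdot> f = h \<boxminus> e"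
      using cokernel_desc[OF c] by blast
    then have "e = h \<boxminus> g \<cdot> f" using e h by (auto simp: preadd_simps)
    then show ?thesis using g by blast
  qed
  then have "(\<exists>g \<in> Hom C (Cod C f) T. Q (h \<boxminus> g \<cdot> f)) \<longleftrightarrow>
      (\<exists>e \<in> Hom C (Dom C f) T. e \<cdot> ?k = h \<cdot> ?k \<and> Q e)"
    using d by metis
  also have "\<dots> \<longleftrightarrow> extends_within_image C ?k h"
    unfolding extends_within_image_def Q_def using h K by (auto simp: Hom_def)
  finally show ?thesis using sum[OF d(1)] by blast
qed

end

section \<open>Arrows factoring through projectives of \<open>\<T>\<close>\<close>

locale projective_subcategory = abelian_category +
  fixes \<T> :: "'a set"
  assumes \<T>_Ob: "\<T> \<subseteq> Ob C"
    and \<T>_projective: "P \<in> \<T> \<Longrightarrow> is_projective C P"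
    and \<T>_sums: "closed_under_finite_direct_sums C \<T>"
    and \<T>_summands: "closed_under_direct_summands C \<T>"
begin

abbreviation ft :: "'b \<Rightarrow> bool" where
  "ft f \<equiv> factors_through_class C \<T> f"

lemma ftI: "\<lbrakk>a \<in> Ar C; b \<in> Ar C; Cod C a = Dom C b; Dom C b \<in> \<T>\<rbrakk> \<Longrightarrow> ft (b \<cdot> a)"
  unfolding factors_through_class_def
  by (intro conjI bexI[of _ "Dom C b"] bexI[of _ a] bexI[of _ b]) (simp_all add: cat_simps)

lemma ftE:
  assumes "ft f"
  obtains P a b where "P \<in> \<T>" "a \<in> Ar C" "b \<in> Ar C" "Dom C a = Dom C f" "Cod C a = P"
    "Dom C b = P" "Cod C b = Cod C f" "f = b \<cdot> a"
  using assms unfolding factors_through_class_def by (auto simp: Hom_def)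

lemma ft_Ar: "ft f \<Longrightarrow> f \<in> Ar C"
  by (simp add: factors_through_class_def)

lemma ft_comp_left:
  assumes "ft f" "g \<in> Ar C" "Cod C f = Dom C g"
  shows "ft (g \<cdot> f)"
  using assms(1)
proof (rule ftE)
  fix P a b assume a: "P \<in> \<T>" "a \<in> Ar C" "b \<in> Ar C" "Dom C a = Dom C f" "Cod C a = P"
    "Dom C b = P" "Cod C b = Cod C f" and f: "f = b \<cdot> a"
  have "ft ((g \<cdot> b) \<cdot> a)" by (rule ftI) (use a assms(2,3) in \<open>auto simp: cat_simps\<close>)
  then show ?thesis unfolding f using a assms(2,3) by (simp add: cat_simps)
qed

lemma ft_comp_right:
  assumes "ft f" "g \<in> Ar C" "Cod C g = Dom C f"
  shows "ft (f \<cdot> g)"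
  using assms(1)
proof (rule ftE)
  fix P a b assume a: "P \<in> \<T>" "a \<in> Ar C" "b \<in> Ar C" "Dom C a = Dom C f" "Cod C a = P"
    "Dom C b = P" "Cod C b = Cod C f" and f: "f = b \<cdot> a"
  have "ft (b \<cdot> (a \<cdot> g))" by (rule ftI) (use a assms(2,3) in \<open>auto simp: cat_simps\<close>)
  then show ?thesis unfolding f using a assms(2,3) by (simp add: cat_simps)
qed

lemma ft_zero:
  assumes "X \<in> Ob C" "Y \<in> Ob C"
  shows "ft (Zero C X Y)"
proof -
  obtain Z where Z: "is_zero_object C Z" using ex_zero_object by blast
  then have "Z \<in> \<T>" using \<T>_sums unfolding closed_under_finite_direct_sums_def by blast
  moreover have "Z \<in> Ob C" using Z by (simp add: is_zero_object_def)
  ultimately show ?thesis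
    using ftI[of "Zero C X Z" "Zero C Z Y"] assms by (simp add: preadd_simps)
qed

text \<open>If \<open>f\<close> factors through \<open>P\<close> and \<open>g\<close> through \<open>Q\<close>, then \<open>f - g\<close> factors through
  \<open>P \<oplus> Q\<close>.\<close>

lemma ft_diff:
  assumes f: "ft f" and g: "ft g" and par: "Dom C f = Dom C g" "Cod C f = Cod C g"
  shows "ft (f \<boxminus> g)"
proof -
  obtain P a b where a: "P \<in> \<T>" "a \<in> Ar C" "b \<in> Ar C" "Dom C a = Dom C g" "Cod C a = P"
    "Dom C b = P" "Cod C b = Cod C g" "f = b \<cdot> a" using f par by (auto elim: ftE)
  obtain Q c d where c: "Q \<in> \<T>" "c \<in> Ar C" "d \<in> Ar C" "Dom C c = Dom C g" "Cod C c = Q"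
    "Dom C d = Q" "Cod C d = Cod C g" "g = d \<cdot> c" using g by (auto elim: ftE)
  obtain S i1 i2 p1 p2 where D: "is_direct_sum C P Q S i1 i2 p1 p2"
    using ex_direct_sum \<T>_Ob a(1) c(1) by blast
  have S: "S \<in> \<T>"
    using \<T>_sums D a(1) c(1) unfolding closed_under_finite_direct_sums_def by blast
  note DD = direct_sumD[OF D]
  have "ft ((b \<cdot> p1 \<boxminus> d \<cdot> p2) \<cdot> (i1 \<cdot> a \<boxplus> i2 \<cdot> c))"
    by (rule ftI) (use a(1-7) c(1-7) DD S in \<open>auto simp: preadd_simps\<close>)
  also have "(b \<cdot> p1 \<boxminus> d \<cdot> p2) \<cdot> (i1 \<cdot> a \<boxplus> i2 \<cdot> c) = b \<cdot> a \<boxminus> d \<cdot> c"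
    using a(1-7) c(1-7) DD direct_sum_cancel[OF D] dom_in_Ob[of a] cod_in_Ob[of b]
    by (auto simp: preadd_simps add_zero_diff)
  finally show ?thesis using a c by simp
qed

lemma ft_of_diff:
  assumes "ft (f \<boxminus> g)" "ft g" "f \<in> Ar C" "Dom C f = Dom C g" "Cod C f = Cod C g"
  shows "ft f"
proof -
  have g: "g \<in> Ar C" using assms(2) by (rule ft_Ar)
  have z: "ft (Zero C (Dom C g) (Cod C g) \<boxminus> g)"
    by (rule ft_diff[OF ft_zero assms(2)]) (use g in \<open>auto simp: preadd_simps\<close>)
  have "ft ((f \<boxminus> g) \<boxminus> (Zero C (Dom C g) (Cod C g) \<boxminus> g))"
    by (rule ft_diff[OF assms(1) z]) (use g assms in \<open>auto simp: preadd_simps\<close>)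
  also have "(f \<boxminus> g) \<boxminus> (Zero C (Dom C g) (Cod C g) \<boxminus> g) = f"
    using g assms diff_chain[of f "Zero C (Dom C g) (Cod C g)" g] by (simp add: preadd_simps)
  finally show ?thesis .
qed

lemma ft_sym:
  assumes "ft (f \<boxminus> g)" "f \<in> Ar C" "g \<in> Ar C" "Dom C f = Dom C g" "Cod C f = Cod C g"
  shows "ft (g \<boxminus> f)"
proof -
  have "ft ((g \<boxminus> g) \<boxminus> (f \<boxminus> g))"
    by (rule ft_diff[OF _ assms(1)]) (use assms in \<open>auto simp: preadd_simps intro: ft_zero\<close>)
  also have "(g \<boxminus> g) \<boxminus> (f \<boxminus> g) = g \<boxminus> f"
    by (rule diff_chain) (use assms in auto)
  finally show ?thesis .
qed

text \<open>The second factor of \<open>v\<close> starts at a projective object, so it lifts along \<open>c\<close>.\<close>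

lemma ft_lift_epi:
  assumes "ft v" "is_epi C c" "Cod C c = Cod C v"
  obtains w where "w \<in> Hom C (Dom C v) (Dom C c)" "c \<cdot> w = v" "ft w"
  using assms(1)
proof (rule ftE)
  fix P a b assume a: "P \<in> \<T>" "a \<in> Ar C" "b \<in> Ar C" "Dom C a = Dom C v" "Cod C a = P"
    "Dom C b = P" "Cod C b = Cod C v" and v: "v = b \<cdot> a"
  have "\<forall>x \<in> Hom C P (Cod C c). \<exists>s \<in> Hom C P (Dom C c). c \<cdot> s = x"
    using \<T>_projective[OF a(1)] assms(2) unfolding is_projective_def by blast
  moreover have "b \<in> Hom C P (Cod C c)" using a assms(3) by (simp add: Hom_def)
  ultimately obtain s where s: "s \<in> Hom C P (Dom C c)" "c \<cdot> s = b" by blast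
  have cA: "c \<in> Ar C" using assms(2) by (simp add: is_epi_def)
  show thesis
  proof (rule that)
    show "s \<cdot> a \<in> Hom C (Dom C v) (Dom C c)" using s a(1-7) by (auto simp: cat_simps)
    show "c \<cdot> (s \<cdot> a) = v" unfolding v s(2)[symmetric] using s(1) a(1-7) cA by (auto simp: cat_simps)
    show "ft (s \<cdot> a)" by (rule ftI) (use s(1) a in \<open>auto simp: Hom_def\<close>)
  qed
qed

text \<open>An object isomorphic to \<open>S\<close> is a direct summand of \<open>S\<close> whose complement is a zero object.\<close>

lemma \<T>_iso_closed:
  assumes S: "S \<in> \<T>" and u: "u \<in> Hom C X S" "v \<in> Hom C S X" "u \<cdot> v = Id C S" "v \<cdot> u = Id C X"
  shows "X \<in> \<T>"
proof -
  obtain Z where Z: "is_zero_object C Z" using ex_zero_object by blast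
  then have ZO: "Z \<in> Ob C" by (simp add: is_zero_object_def)
  then have "\<exists>!f. f \<in> Hom C Z Z" using Z unfolding is_zero_object_def by blast
  moreover have "Zero C Z Z \<in> Hom C Z Z" "Id C Z \<in> Hom C Z Z"
    using ZO by (auto simp: add_simps)
  ultimately have "Zero C Z Z = Id C Z" by blast
  then have "is_direct_sum C X Z S u (Zero C Z S) v (Zero C S Z)"
    unfolding is_direct_sum_def using u ZO by (auto simp: preadd_simps)
  then show ?thesis using \<T>_summands S unfolding closed_under_direct_summands_def by blast
qed

lemma kernel_object_in_\<T>:
  assumes k: "is_kernel C f k" and k': "is_kernel C f k'" and T: "Dom C k \<in> \<T>"
  shows "Dom C k' \<in> \<T>"
proof -
  note K = is_kernelD[OF k] and K' = is_kernelD[OF k']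
  obtain u where u: "u \<in> Hom C (Dom C k') (Dom C k)" "k \<cdot> u = k'" by (rule kernels_factor[OF k k'])
  obtain v where v: "v \<in> Hom C (Dom C k) (Dom C k')" "k' \<cdot> v = k" by (rule kernels_factor[OF k' k])
  have "k \<cdot> (u \<cdot> v) = (k \<cdot> u) \<cdot> v" "k' \<cdot> (v \<cdot> u) = (k' \<cdot> v) \<cdot> u"
    using u(1) v(1) K(2) K'(2) by (auto simp: cat_simps)
  then have "k \<cdot> (u \<cdot> v) = k" "k' \<cdot> (v \<cdot> u) = k'"
    unfolding u(2) v(2) by blast+
  then have "u \<cdot> v = Id C (Dom C k)" "v \<cdot> u = Id C (Dom C k')"
    using mono_comp_eq_self kernel_mono[OF k] kernel_mono[OF k'] comp_in_Hom u(1) v(1) by blast+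
  then show ?thesis using \<T>_iso_closed[OF T u(1) v(1)] by blast
qed

definition extension_property :: "'b \<Rightarrow> bool" where
  "extension_property \<mu> \<longleftrightarrow> (\<forall>T \<in> \<T>. \<forall>h \<in> Hom C (Cod C \<mu>) T. extends_within_image C \<mu> h)"

section \<open>Bimorphisms of the stable category\<close>

text \<open>The stable category being additive, its monomorphisms and epimorphisms are recognised on
  the arrows that become zero, that is, on those factoring through \<open>\<T>\<close>.\<close>

definition stably_mono :: "'b \<Rightarrow> bool" where
  "stably_mono f \<longleftrightarrow> (\<forall>X. \<forall>u \<in> Hom C X (Dom C f). ft (f \<cdot> u) \<longrightarrow> ft u)"

definition stably_epi :: "'b \<Rightarrow> bool" where
  "stably_epi f \<longleftrightarrow> (\<forall>Y. \<forall>v \<in> Hom C (Cod C f) Y. ft (v \<cdot> f) \<longrightarrow> ft v)"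

definition stable_inverse :: "'b \<Rightarrow> 'b \<Rightarrow> bool" where
  "stable_inverse f g \<longleftrightarrow> ft (g \<cdot> f \<boxminus> Id C (Dom C f)) \<and> ft (f \<cdot> g \<boxminus> Id C (Cod C f))"

text \<open>The composite \<open>f \<cdot> k = 0\<close> shows necessity. Conversely, if \<open>f \<cdot> u\<close> factors through \<open>\<T>\<close>,
  lift it along \<open>f\<close> to some \<open>w\<close> factoring through \<open>\<T>\<close>; then \<open>u - w\<close> factors through \<open>k\<close>.\<close>

lemma epi_stably_mono_iff:
  assumes f: "is_epi C f" and k: "is_kernel C f k"
  shows "stably_mono f \<longleftrightarrow> ft k"
proof
  note K = is_kernelD[OF k]
  assume "stably_mono f"
  moreover have "ft (f \<cdot> k)" unfolding K(4) using K by (intro ft_zero) (auto simp: cat_simps)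
  ultimately show "ft k" using K unfolding stably_mono_def by (auto simp: Hom_def)
next
  note K = is_kernelD[OF k]
  assume ftk: "ft k"
  show "stably_mono f" unfolding stably_mono_def
  proof (intro allI ballI impI)
    fix X u assume u: "u \<in> Hom C X (Dom C f)" and fu: "ft (f \<cdot> u)"
    obtain w where w: "w \<in> Hom C (Dom C (f \<cdot> u)) (Dom C f)" "f \<cdot> w = f \<cdot> u" "ft w"
      using ft_lift_epi[OF fu f] u K by (auto simp: cat_simps)
    have "f \<cdot> (u \<boxminus> w) = Zero C X (Cod C f)" "u \<boxminus> w \<in> Hom C X (Dom C f)"
      using w u K by (auto simp: preadd_simps)
    then obtain x where x: "x \<in> Hom C X (Dom C k)" "k \<cdot> x = u \<boxminus> w"
      using kernel_lift[OF k] by blast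
    have "ft (u \<boxminus> w)" unfolding x(2)[symmetric]
      using ft_comp_right[OF ftk] x(1) by (auto simp: Hom_def)
    then show "ft u" by (rule ft_of_diff[OF _ w(3)]) (use u w K in \<open>auto simp: cat_simps\<close>)
  qed
qed

text \<open>If \<open>f\<close> is stably an epimorphism and \<open>h : M \<rightarrow> T\<close> is given, let \<open>c\<close> be the cokernel of
  \<open>h \<cdot> k\<close>. Then \<open>c \<cdot> h = v \<cdot> f\<close> for some \<open>v\<close>, and \<open>c \<cdot> h\<close> factors through \<open>T\<close>; so \<open>v\<close> factors
  through \<open>\<T>\<close> and lifts along \<open>c\<close> to some \<open>w\<close>. The desired extension is \<open>h - w \<cdot> f\<close>, as \<open>c\<close> kills
  it. Conversely, let \<open>v \<cdot> f = b \<cdot> h\<close> factor through \<open>T\<close>. The extension \<open>e\<close> for \<open>h\<close> is killed by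
  \<open>b\<close>, because \<open>b\<close> kills \<open>h \<cdot> k\<close>; and \<open>h - e\<close>, vanishing on \<open>k\<close>, has the form \<open>g \<cdot> f\<close>. Hence
  \<open>v \<cdot> f = b \<cdot> g \<cdot> f\<close> and \<open>v = b \<cdot> g\<close>.\<close>

lemma epi_stably_epi_iff:
  assumes f: "is_epi C f" and k: "is_kernel C f k"
  shows "stably_epi f \<longleftrightarrow> extension_property k"
proof
  note K = is_kernelD[OF k]
  note fc = epi_cokernel_of_kernel[OF f k]
  assume ep: "stably_epi f"
  show "extension_property k" unfolding extension_property_def
  proof (intro ballI)
    fix T h assume T: "T \<in> \<T>" and h: "h \<in> Hom C (Cod C k) T"
    have hk: "h \<cdot> k \<in> Ar C" "Dom C (h \<cdot> k) = Dom C k" "Cod C (h \<cdot> k) = T"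
      using h K by (auto simp: cat_simps)
    define c where "c = coker_mor C (h \<cdot> k)"
    have c: "is_cokernel C (h \<cdot> k) c" unfolding c_def by (rule coker_mor_is_cokernel[OF hk(1)])
    note CC = is_cokernelD[OF c, unfolded hk]
    have "(c \<cdot> h) \<cdot> k = Zero C (Dom C k) (Cod C c)" "c \<cdot> h \<in> Hom C (Cod C k) (Cod C c)"
      using CC h K by (auto simp: cat_simps)
    then obtain v where v: "v \<in> Hom C (Cod C f) (Cod C c)" "v \<cdot> f = c \<cdot> h"
      using cokernel_desc[OF fc] by blast
    have "ft (c \<cdot> h)" by (rule ftI) (use h CC T in \<open>auto simp: Hom_def\<close>)
    then have "ft v" using ep v unfolding stably_epi_def by auto
    then obtain w where w: "w \<in> Hom C (Dom C v) (Dom C c)" "c \<cdot> w = v"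
      using ft_lift_epi[of v c] cokernel_epi[OF c] v(1) by (auto simp: Hom_def)
    define e where "e = h \<boxminus> w \<cdot> f"
    have e: "e \<in> Hom C (Cod C k) T" "e \<cdot> k = h \<cdot> k"
      unfolding e_def using h w v(1) K CC by (auto simp: preadd_simps)
    have "c \<cdot> (w \<cdot> f) = (c \<cdot> w) \<cdot> f" using w(1) v(1) K CC by (auto simp: cat_simps)
    then have ce: "c \<cdot> e = Zero C (Cod C k) (Cod C c)"
      unfolding e_def w(2) v(2) using h w(1) v(1) K CC by (auto simp: preadd_simps)
    have "y \<cdot> e = Zero C (Cod C k) Y"
      if y: "y \<in> Hom C T Y" "y \<cdot> (h \<cdot> k) = Zero C (Dom C k) Y" for Y y
    proof -
      obtain z where z: "z \<in> Hom C (Cod C c) Y" "z \<cdot> c = y"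
        using cokernel_desc[OF c, of y Y] y hk by auto
      have "y \<cdot> e = z \<cdot> (c \<cdot> e)" unfolding z(2)[symmetric] using z(1) e(1) CC by (auto simp: cat_simps)
      also have "\<dots> = Zero C (Cod C k) Y" unfolding ce using z(1) CC K by (auto simp: preadd_simps)
      finally show ?thesis .
    qed
    moreover have "Cod C h = T" using h by (simp add: Hom_def)
    ultimately show "extends_within_image C k h"
      unfolding extends_within_image_def using e by blast
  qed
next
  note K = is_kernelD[OF k]
  note fc = epi_cokernel_of_kernel[OF f k]
  assume ep: "extension_property k"
  show "stably_epi f" unfolding stably_epi_def
  proof (intro allI ballI impI)
    fix Y v assume v: "v \<in> Hom C (Cod C f) Y" and ftv: "ft (v \<cdot> f)"
    have "Dom C (v \<cdot> f) = Cod C k" "Cod C (v \<cdot> f) = Y" using v K by (auto simp: cat_simps)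
    note vfd = this
    obtain T h b where T: "T \<in> \<T>" and hb: "h \<in> Ar C" "b \<in> Ar C" "Dom C h = Cod C k"
      "Cod C h = T" "Dom C b = T" "Cod C b = Y" "v \<cdot> f = b \<cdot> h"
      by (rule ftE[OF ftv, unfolded vfd])
    note h = hb(1,3,4) and b = hb(2,5,6) and vf = hb(7)
    have "extends_within_image C k h"
      using ep T h unfolding extension_property_def by (auto simp: Hom_def)
    then obtain e where e: "e \<in> Hom C (Cod C k) T" "e \<cdot> k = h \<cdot> k"
      and ann: "\<And>Y y. \<lbrakk>y \<in> Hom C T Y; y \<cdot> (h \<cdot> k) = Zero C (Dom C k) Y\<rbrakk>
        \<Longrightarrow> y \<cdot> e = Zero C (Cod C k) Y"
      unfolding extends_within_image_def h by blast
    have "b \<cdot> (h \<cdot> k) = (v \<cdot> f) \<cdot> k" unfolding vf using h b K by (simp add: cat_simps)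
    also have "\<dots> = Zero C (Dom C k) Y" using v K by (auto simp: preadd_simps)
    finally have be: "b \<cdot> e = Zero C (Cod C k) Y" using b by (intro ann) (auto simp: Hom_def)
    have "(h \<boxminus> e) \<cdot> k = Zero C (Dom C k) T" "h \<boxminus> e \<in> Hom C (Cod C k) T"
      using e h K by (auto simp: preadd_simps)
    then obtain g where g: "g \<in> Hom C (Cod C f) T" "g \<cdot> f = h \<boxminus> e"
      using cokernel_desc[OF fc] by blast
    have "(b \<cdot> g) \<cdot> f = b \<cdot> (h \<boxminus> e)"
      unfolding g(2)[symmetric] using g(1) b K by (auto simp: cat_simps)
    also have "\<dots> = b \<cdot> h" using h e(1) b be by (auto simp: preadd_simps)
    finally have "(b \<cdot> g) \<cdot> f = v \<cdot> f" unfolding vf .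
    then have "b \<cdot> g = v"
      using epi_cancel[OF f, of "b \<cdot> g" v Y] v g(1) b by (auto simp: cat_simps)
    then show "ft v" using ftI[of g b] g(1) b T by (auto simp: Hom_def)
  qed
qed

text \<open>Cancel \<open>f\<close> on the left in \<open>f \<cdot> (g \<cdot> f) = f\<close>, which holds modulo \<open>\<T>\<close>.\<close>

lemma stably_iso_if_right_inverse:
  assumes f: "f \<in> Ar C" "stably_mono f" and g: "g \<in> Hom C (Cod C f) (Dom C f)"
    and fg: "ft (f \<cdot> g \<boxminus> Id C (Cod C f))"
  shows "stable_inverse f g"
proof -
  have ob: "Dom C f \<in> Ob C" "Cod C f \<in> Ob C" using f by (auto simp: cat_simps)
  have "ft ((f \<cdot> g \<boxminus> Id C (Cod C f)) \<cdot> f)"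
    using fg f g ob by (intro ft_comp_right) (auto simp: preadd_simps)
  also have "(f \<cdot> g \<boxminus> Id C (Cod C f)) \<cdot> f = f \<cdot> (g \<cdot> f \<boxminus> Id C (Dom C f))"
    using f(1) g ob by (auto simp: preadd_simps)
  finally have "ft (f \<cdot> (g \<cdot> f \<boxminus> Id C (Dom C f)))" .
  moreover have "g \<cdot> f \<boxminus> Id C (Dom C f) \<in> Hom C (Dom C f) (Dom C f)"
    using f(1) g ob by (auto simp: preadd_simps)
  ultimately have "ft (g \<cdot> f \<boxminus> Id C (Dom C f))" using f(2) unfolding stably_mono_def by blast
  then show ?thesis using fg unfolding stable_inverse_def by blast
qed

text \<open>If \<open>f \<cdot> g - 1\<close> factors through \<open>\<T>\<close>, it lifts along \<open>f\<close> to some \<open>w\<close>, and \<open>g - w\<close> is a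
  genuine section of \<open>f\<close>.\<close>

lemma epi_stably_iso_retraction:
  assumes f: "is_epi C f" and g: "g \<in> Hom C (Cod C f) (Dom C f)" and "stable_inverse f g"
  shows "is_retraction C f"
proof -
  have fA: "f \<in> Ar C" using f by (simp add: is_epi_def)
  have ob: "Cod C f \<in> Ob C" using fA by (auto simp: cat_simps)
  have ft: "ft (f \<cdot> g \<boxminus> Id C (Cod C f))" using assms(3) unfolding stable_inverse_def by blast
  obtain w where w: "w \<in> Hom C (Cod C f) (Dom C f)" "f \<cdot> w = f \<cdot> g \<boxminus> Id C (Cod C f)"
    using ft_lift_epi[OF ft f] fA g ob by (auto simp: preadd_simps)
  have "f \<cdot> (g \<boxminus> w) = Id C (Cod C f)" using w g fA ob by (auto simp: preadd_simps)
  moreover have "g \<boxminus> w \<in> Hom C (Cod C f) (Dom C f)" using w(1) g by (auto simp: preadd_simps)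
  ultimately show ?thesis using fA unfolding is_retraction_def by blast
qed

text \<open>Passing from \<open>M\<close> to \<open>M \<oplus> P\<close> with \<open>P \<in> \<T>\<close> changes nothing in the stable category, and
  turns a stable epimorphism \<open>f : M \<rightarrow> N\<close> into an epimorphism: since \<open>c \<cdot> f = 0\<close> for the
  cokernel \<open>c\<close> of \<open>f\<close>, the arrow \<open>c\<close> itself factors through \<open>\<T>\<close>, so
  \<open>c = b \<cdot> a\<close> with \<open>b\<close> starting at some \<open>P \<in> \<T>\<close>, and the lift \<open>s : P \<rightarrow> N\<close> of \<open>b\<close> along \<open>c\<close>
  reaches what the image of \<open>f\<close> misses.\<close>

lemma stably_epi_completion:
  assumes f: "f \<in> Ar C" "stably_epi f"
  obtains P s S i1 i2 p1 p2 where "P \<in> \<T>" "s \<in> Hom C P (Cod C f)"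
    "is_direct_sum C (Dom C f) P S i1 i2 p1 p2" "is_epi C (f \<cdot> p1 \<boxplus> s \<cdot> p2)"
proof -
  define c where "c = coker_mor C f"
  have c: "is_cokernel C f c" unfolding c_def by (rule coker_mor_is_cokernel[OF f(1)])
  note CC = is_cokernelD[OF c]
  have "ft (c \<cdot> f)" unfolding CC(4) using CC(1,2) by (intro ft_zero) (auto simp: cat_simps)
  then have "ft c" using f(2) CC unfolding stably_epi_def by (auto simp: Hom_def)
  then obtain P a b where P: "P \<in> \<T>" and a: "a \<in> Ar C" "Dom C a = Cod C f" "Cod C a = P"
    and b: "b \<in> Ar C" "Dom C b = P" "Cod C b = Cod C c" and cab: "c = b \<cdot> a"
    using CC(3) by (auto elim: ftE)
  have "ft (b \<cdot> Id C P)" by (rule ftI) (use b P \<T>_Ob in \<open>auto simp: cat_simps\<close>)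
  then have "ft b" using b by (simp add: cat_simps)
  then obtain s where s: "s \<in> Hom C P (Cod C f)" "c \<cdot> s = b"
    using ft_lift_epi[of b c] cokernel_epi[OF c] b CC(3) by auto
  obtain S i1 i2 p1 p2 where D: "is_direct_sum C (Dom C f) P S i1 i2 p1 p2"
    using ex_direct_sum[OF dom_in_Ob[OF f(1)]] P \<T>_Ob by blast
  note DD = direct_sumD[OF D]
  have "is_epi C (f \<cdot> p1 \<boxplus> s \<cdot> p2)"
  proof (rule epiI)
    let ?m = "f \<cdot> p1 \<boxplus> s \<cdot> p2"
    show mA: "?m \<in> Ar C" using f(1) s(1) DD by (auto simp: preadd_simps)
    have mDC: "Dom C ?m = S" "Cod C ?m = Cod C f" using f(1) s(1) DD by (auto simp: preadd_simps)
    have mi: "?m \<cdot> i1 = f" "?m \<cdot> i2 = s" using f(1) s(1) DD by (auto simp: preadd_simps)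
    fix Y y assume y: "y \<in> Hom C (Cod C ?m) Y" "y \<cdot> ?m = Zero C (Dom C ?m) Y"
    have "y \<cdot> (?m \<cdot> i1) = (y \<cdot> ?m) \<cdot> i1" "y \<cdot> (?m \<cdot> i2) = (y \<cdot> ?m) \<cdot> i2"
      using y(1) mA mDC DD(4-11) comp_assoc_Ar by (auto simp: Hom_def)
    then have yf: "y \<cdot> f = Zero C (Dom C f) Y" and ys: "y \<cdot> s = Zero C P Y"
      unfolding y(2) mi using y(1) DD mDC by (auto simp: preadd_simps)
    obtain d where d: "d \<in> Hom C (Cod C c) Y" "d \<cdot> c = y"
      using cokernel_desc[OF c, of y Y] y(1) yf mDC by auto
    have "d \<cdot> b = y \<cdot> s" unfolding s(2)[symmetric] d(2)[symmetric]
      using d(1) s(1) CC by (auto simp: cat_simps)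
    then have db: "d \<cdot> b = Zero C P Y" using ys by simp
    have "y = (d \<cdot> b) \<cdot> a" unfolding d(2)[symmetric] cab using d(1) a b by (auto simp: cat_simps)
    then show "y = Zero C (Cod C ?m) Y" unfolding db mDC using a d(1) by (auto simp: preadd_simps)
  qed
  then show thesis using that P s(1) D by blast
qed

lemma completion_stably_mono:
  assumes f: "f \<in> Ar C" "stably_mono f" and P: "P \<in> \<T>" and s: "s \<in> Hom C P (Cod C f)"
    and D: "is_direct_sum C (Dom C f) P S i1 i2 p1 p2"
  shows "stably_mono (f \<cdot> p1 \<boxplus> s \<cdot> p2)"
  unfolding stably_mono_def
proof (intro allI ballI impI)
  note DD = direct_sumD[OF D]
  let ?m = "f \<cdot> p1 \<boxplus> s \<cdot> p2"
  fix X u assume u: "u \<in> Hom C X (Dom C ?m)" and mu: "ft (?m \<cdot> u)"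
  have uA: "u \<in> Ar C" "Dom C u = X" "Cod C u = S"
    using u f(1) s DD by (auto simp: preadd_simps)
  have "ft (s \<cdot> (p2 \<cdot> u))" by (rule ftI) (use s uA DD P in \<open>auto simp: cat_simps\<close>)
  then have "ft (?m \<cdot> u \<boxminus> s \<cdot> (p2 \<cdot> u))"
    using mu uA f(1) s DD by (intro ft_diff) (auto simp: preadd_simps)
  also have "?m \<cdot> u \<boxminus> s \<cdot> (p2 \<cdot> u) = f \<cdot> (p1 \<cdot> u)"
    using uA f(1) s DD(1-15) by (auto simp: preadd_simps)
  finally have "ft (p1 \<cdot> u)"
    using f(2) uA DD(1-15) unfolding stably_mono_def by (auto simp: cat_simps)
  then have 1: "ft (i1 \<cdot> (p1 \<cdot> u))"
    by (rule ft_comp_left) (use uA DD(1-15) in \<open>auto simp: cat_simps\<close>)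
  have 2: "ft (i2 \<cdot> (p2 \<cdot> u))" by (rule ftI) (use uA DD(1-15) P in \<open>auto simp: cat_simps\<close>)
  have "i1 \<cdot> (p1 \<cdot> u) = u \<boxminus> i2 \<cdot> (p2 \<cdot> u)"
    using direct_sum_decompose[OF D uA(1) uA(3)] uA DD(1-15)
      add_diff_cancel[of "i1 \<cdot> (p1 \<cdot> u)" "i2 \<cdot> (p2 \<cdot> u)"]
    by (simp add: cat_simps)
  then show "ft u"
    using ft_of_diff[OF _ 2, of u] 1 uA DD(1-15) by (auto simp: cat_simps)
qed

lemma completion_stably_epi:
  assumes f: "f \<in> Ar C" "stably_epi f" and s: "s \<in> Hom C P (Cod C f)"
    and D: "is_direct_sum C (Dom C f) P S i1 i2 p1 p2"
  shows "stably_epi (f \<cdot> p1 \<boxplus> s \<cdot> p2)"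
  unfolding stably_epi_def
proof (intro allI ballI impI)
  note DD = direct_sumD[OF D]
  let ?m = "f \<cdot> p1 \<boxplus> s \<cdot> p2"
  have m: "?m \<in> Ar C" "Dom C ?m = S" "Cod C ?m = Cod C f" "?m \<cdot> i1 = f"
    using f(1) s DD by (auto simp: preadd_simps)
  fix Y v assume v: "v \<in> Hom C (Cod C ?m) Y" and vm: "ft (v \<cdot> ?m)"
  have "ft ((v \<cdot> ?m) \<cdot> i1)"
    by (rule ft_comp_right[OF vm]) (use v m(1-3) DD(1-15) in \<open>auto simp: cat_simps\<close>)
  also have "(v \<cdot> ?m) \<cdot> i1 = v \<cdot> (?m \<cdot> i1)"
    using v m(1-3) DD(1-15) comp_assoc_Ar by (auto simp: Hom_def)
  finally have "ft (v \<cdot> f)" unfolding m(4) .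
  then show "ft v" using f(2) v m unfolding stably_epi_def by auto
qed

text \<open>From right to left, the completion \<open>(f, s) : M \<oplus> P \<rightarrow> N\<close> of a bimorphism \<open>f\<close> is an
  epimorphism to which the hypothesis applies. The first component of a section of it is a right
  inverse of \<open>f\<close> modulo \<open>\<T>\<close>, since the second one contributes an arrow through \<open>P\<close>.\<close>

theorem bimorphisms_invertible_iff:
  "(\<forall>f \<in> Ar C. stably_mono f \<and> stably_epi f \<longrightarrow>
      (\<exists>g \<in> Hom C (Cod C f) (Dom C f). stable_inverse f g)) \<longleftrightarrow>
    (\<forall>f. is_epi C f \<and> ft (ker_mor C f) \<and> extension_property (ker_mor C f) \<longrightarrow> is_retraction C f)"
    (is "?L \<longleftrightarrow> ?R")
proof
  show ?R if ?L
  proof (intro allI impI, elim conjE)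
    fix f assume f: "is_epi C f" "ft (ker_mor C f)" "extension_property (ker_mor C f)"
    have fA: "f \<in> Ar C" using f by (simp add: is_epi_def)
    note k = ker_mor_is_kernel[OF fA]
    have "stably_mono f" "stably_epi f"
      using epi_stably_mono_iff[OF f(1) k] epi_stably_epi_iff[OF f(1) k] f by auto
    then show "is_retraction C f" using \<open>?L\<close> fA epi_stably_iso_retraction[OF f(1)] by blast
  qed
  show ?L if ?R
  proof (intro ballI impI, elim conjE)
    fix f assume f: "f \<in> Ar C" "stably_mono f" "stably_epi f"
    obtain P s S i1 i2 p1 p2 where P: "P \<in> \<T>" and s: "s \<in> Hom C P (Cod C f)"
      and D: "is_direct_sum C (Dom C f) P S i1 i2 p1 p2" and m: "is_epi C (f \<cdot> p1 \<boxplus> s \<cdot> p2)"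
      using stably_epi_completion[OF f(1,3)] .
    note DD = direct_sumD[OF D]
    let ?m = "f \<cdot> p1 \<boxplus> s \<cdot> p2"
    have mA: "?m \<in> Ar C" using m by (simp add: is_epi_def)
    note k = ker_mor_is_kernel[OF mA]
    have "ft (ker_mor C ?m)" "extension_property (ker_mor C ?m)"
      using epi_stably_mono_iff[OF m k] epi_stably_epi_iff[OF m k]
        completion_stably_mono[OF f(1,2) P s D] completion_stably_epi[OF f(1,3) s D] by auto
    then have "is_retraction C ?m" using \<open>?R\<close> m by blast
    then obtain t where t: "t \<in> Hom C (Cod C f) S" "?m \<cdot> t = Id C (Cod C f)"
      using f(1) s DD unfolding is_retraction_def by (auto simp: preadd_simps)
    have ob: "Cod C f \<in> Ob C" using f(1) by (simp add: cat_simps)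
    have p1t: "p1 \<cdot> t \<in> Hom C (Cod C f) (Dom C f)" using t DD by (auto simp: cat_simps)
    have ft2: "ft (s \<cdot> (p2 \<cdot> t))" by (rule ftI) (use s t DD P in \<open>auto simp: cat_simps\<close>)
    have sum: "f \<cdot> (p1 \<cdot> t) \<boxplus> s \<cdot> (p2 \<cdot> t) = Id C (Cod C f)"
      unfolding t(2)[symmetric] using f(1) s t(1) DD(1-15) by (auto simp: preadd_simps)
    have "f \<cdot> (p1 \<cdot> t) = Id C (Cod C f) \<boxminus> s \<cdot> (p2 \<cdot> t)"
      unfolding sum[symmetric] using f(1) s t(1) DD(1-15) by (auto simp: preadd_simps)
    then have "Id C (Cod C f) \<boxminus> f \<cdot> (p1 \<cdot> t) = s \<cdot> (p2 \<cdot> t)"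
      using f(1) s t(1) DD(1-15) ob by (auto simp: preadd_simps)
    then have "ft (f \<cdot> (p1 \<cdot> t) \<boxminus> Id C (Cod C f))"
      using ft2 ft_sym[of "Id C (Cod C f)" "f \<cdot> (p1 \<cdot> t)"] f(1) p1t ob by (auto simp: preadd_simps)
    then show "\<exists>g \<in> Hom C (Cod C f) (Dom C f). stable_inverse f g"
      using stably_iso_if_right_inverse[OF f(1,2) p1t] p1t by blast
  qed
qed

end

section \<open>The stable category\<close>

context projective_subcategory
begin

abbreviation cl :: "'b \<Rightarrow> 'b set" where
  "cl f \<equiv> stable_rel C \<T> `` {f}"

abbreviation St :: "('a, 'b set) cat" where
  "St \<equiv> stable_category C \<T>"

lemma stable_rel_iff: "(f, g) \<in> stable_rel C \<T> \<longleftrightarrow>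
    f \<in> Ar C \<and> g \<in> Ar C \<and> Dom C f = Dom C g \<and> Cod C f = Cod C g \<and> ft (f \<boxminus> g)"
  by (simp add: stable_rel_def)

lemma equiv_stable_rel: "equiv (Ar C) (stable_rel C \<T>)"
proof (rule equivI)
  show "stable_rel C \<T> \<subseteq> Ar C \<times> Ar C" by (auto simp: stable_rel_iff)
  show "refl_on (Ar C) (stable_rel C \<T>)"
    by (auto simp: refl_on_def stable_rel_iff diff_same intro: ft_zero dom_in_Ob cod_in_Ob)
  show "sym (stable_rel C \<T>)"
    by (rule symI) (auto simp: stable_rel_iff intro: ft_sym)
  show "trans (stable_rel C \<T>)"
  proof (rule transI)
    fix f g h assume a: "(f, g) \<in> stable_rel C \<T>" "(g, h) \<in> stable_rel C \<T>"
    then have A: "f \<in> Ar C" "g \<in> Ar C" "h \<in> Ar C" "Dom C f = Dom C h" "Cod C f = Cod C h"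
      "Dom C g = Dom C h" "Cod C g = Cod C h" and ft: "ft (f \<boxminus> g)" "ft (g \<boxminus> h)"
      by (auto simp: stable_rel_iff)
    have "ft (h \<boxminus> g)" by (rule ft_sym[OF ft(2)]) (use A in auto)
    then have "ft ((f \<boxminus> g) \<boxminus> (h \<boxminus> g))"
      by (rule ft_diff[OF ft(1)]) (use A in \<open>auto simp: preadd_simps\<close>)
    also have "(f \<boxminus> g) \<boxminus> (h \<boxminus> g) = f \<boxminus> h" by (rule diff_chain) (use A in auto)
    finally show "(f, h) \<in> stable_rel C \<T>" using A by (simp add: stable_rel_iff)
  qed
qed

lemma cl_eq_iff:
  assumes "f \<in> Ar C" "g \<in> Ar C" "Dom C f = Dom C g" "Cod C f = Cod C g"
  shows "cl f = cl g \<longleftrightarrow> ft (f \<boxminus> g)"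
  using eq_equiv_class_iff[OF equiv_stable_rel assms(1,2)] assms by (simp add: stable_rel_iff)

lemma St_Ar: "F \<in> Ar St \<longleftrightarrow> (\<exists>f \<in> Ar C. F = cl f)"
  by (auto simp: stable_category_def quotient_def)

lemma cl_self: "f \<in> Ar C \<Longrightarrow> f \<in> cl f"
  using equiv_class_self[OF equiv_stable_rel] .

lemma St_Dom: "f \<in> Ar C \<Longrightarrow> Dom St (cl f) = Dom C f"
  and St_Cod: "f \<in> Ar C \<Longrightarrow> Cod St (cl f) = Cod C f"
proof -
  assume f: "f \<in> Ar C"
  define g where "g = (SOME g. g \<in> cl f)"
  have "g \<in> cl f" unfolding g_def using someI[of "\<lambda>g. g \<in> cl f"] cl_self[OF f] by blast
  then have "Dom C g = Dom C f" "Cod C g = Cod C f" by (auto simp: stable_rel_iff)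
  then show "Dom St (cl f) = Dom C f" "Cod St (cl f) = Cod C f"
    unfolding g_def stable_category_def by simp_all
qed

lemma St_Id: "Id St X = cl (Id C X)"
  by (simp add: stable_category_def)

lemma St_Hom: "F \<in> Hom St X Y \<longleftrightarrow> (\<exists>f \<in> Hom C X Y. F = cl f)"
  unfolding Hom_def using St_Ar St_Dom St_Cod by auto

lemma cl_in_Hom: "f \<in> Hom C X Y \<Longrightarrow> cl f \<in> Hom St X Y"
  using St_Hom by blast

text \<open>Composition in the stable category is a union over all representatives; this makes the
  union a single class.\<close>

lemma comp_stable_rel:
  assumes f: "(f, f') \<in> stable_rel C \<T>" and g: "(g, g') \<in> stable_rel C \<T>" and "Cod C f = Dom C g"
  shows "(g \<cdot> f, g' \<cdot> f') \<in> stable_rel C \<T>"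
proof -
  have A: "f \<in> Ar C" "f' \<in> Ar C" "g \<in> Ar C" "g' \<in> Ar C" "Dom C f = Dom C f'" "Cod C f = Dom C g'"
    "Cod C f' = Dom C g'" "Dom C g = Dom C g'" "Cod C g = Cod C g'"
    and ft: "ft (f \<boxminus> f')" "ft (g \<boxminus> g')"
    using assms by (auto simp: stable_rel_iff)
  have "ft ((g \<boxminus> g') \<cdot> f)"
    by (rule ft_comp_right[OF ft(2)]) (use A in \<open>auto simp: preadd_simps\<close>)
  then have 1: "(g \<cdot> f, g' \<cdot> f) \<in> stable_rel C \<T>"
    using A by (simp add: stable_rel_iff preadd_simps)
  have "ft (g' \<cdot> (f \<boxminus> f'))"
    by (rule ft_comp_left[OF ft(1)]) (use A in \<open>auto simp: preadd_simps\<close>)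
  then have "(g' \<cdot> f, g' \<cdot> f') \<in> stable_rel C \<T>"
    using A by (simp add: stable_rel_iff preadd_simps)
  with 1 show ?thesis using equiv_stable_rel unfolding equiv_def trans_def by blast
qed

lemma St_Comp:
  assumes "f \<in> Ar C" "g \<in> Ar C" "Cod C f = Dom C g"
  shows "cl g \<cdot>\<^bsub>St\<^esub> cl f = cl (g \<cdot> f)"
proof -
  have "cl (g' \<cdot> f') = cl (g \<cdot> f)" if "g' \<in> cl g" "f' \<in> cl f" for g' f'
    using equiv_class_eq[OF equiv_stable_rel comp_stable_rel[of f f' g g']] that assms by simp
  then have "(\<Union>g' \<in> cl g. \<Union>f' \<in> cl f. cl (g' \<cdot> f')) = cl (g \<cdot> f)"
    using cl_self assms by blast
  then show ?thesis by (simp add: stable_category_def)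
qed

lemma St_mono_iff:
  assumes f: "f \<in> Ar C"
  shows "is_mono St (cl f) \<longleftrightarrow> stably_mono f"
proof
  assume m: "is_mono St (cl f)"
  show "stably_mono f" unfolding stably_mono_def
  proof (intro allI ballI impI)
    fix X u assume u: "u \<in> Hom C X (Dom C f)" and fu: "ft (f \<cdot> u)"
    let ?z = "Zero C X (Dom C f)"
    have uA: "u \<in> Ar C" "Dom C u = X" "Cod C u = Dom C f" "X \<in> Ob C" "Dom C f \<in> Ob C" "Cod C f \<in> Ob C"
      using u f by (auto simp: cat_simps)
    have "cl (f \<cdot> u) = cl (f \<cdot> ?z)"
      by (subst cl_eq_iff) (use uA f fu in \<open>simp_all add: preadd_simps\<close>)
    then have "cl f \<cdot>\<^bsub>St\<^esub> cl u = cl f \<cdot>\<^bsub>St\<^esub> cl ?z"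
      using uA f by (simp add: St_Comp preadd_simps)
    moreover have "cl u \<in> Hom St X (Dom St (cl f))" "cl ?z \<in> Hom St X (Dom St (cl f))"
      unfolding St_Dom[OF f] using uA by (intro cl_in_Hom, simp add: preadd_simps)+
    ultimately have "cl u = cl ?z" using m unfolding is_mono_def by blast
    then have "ft (u \<boxminus> ?z)" using cl_eq_iff[of u ?z] uA by (simp add: preadd_simps)
    then show "ft u" using uA by (simp add: preadd_simps)
  qed
next
  assume m: "stably_mono f"
  show "is_mono St (cl f)" unfolding is_mono_def
  proof (intro conjI allI ballI impI)
    show "cl f \<in> Ar St" using f St_Ar by blast
    fix X G H assume "G \<in> Hom St X (Dom St (cl f))" "H \<in> Hom St X (Dom St (cl f))"
      and eq: "cl f \<cdot>\<^bsub>St\<^esub> G = cl f \<cdot>\<^bsub>St\<^esub> H"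
    then obtain g h where g: "g \<in> Hom C X (Dom C f)" "G = cl g" and h: "h \<in> Hom C X (Dom C f)" "H = cl h"
      using f by (auto simp: St_Hom St_Dom)
    have A: "g \<in> Ar C" "h \<in> Ar C" "Dom C g = X" "Dom C h = X" "Cod C g = Dom C f" "Cod C h = Dom C f"
      using g h by (auto simp: Hom_def)
    have "cl (f \<cdot> g) = cl (f \<cdot> h)" using eq A f unfolding g h by (simp add: St_Comp)
    then have "ft (f \<cdot> (g \<boxminus> h))"
      using cl_eq_iff[of "f \<cdot> g" "f \<cdot> h"] A f by (simp add: preadd_simps)
    then have "ft (g \<boxminus> h)" using m A unfolding stably_mono_def by (simp add: preadd_simps)
    then show "G = H" unfolding g h using cl_eq_iff[of g h] A by simp
  qed
qed

lemma St_epi_iff: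
  assumes f: "f \<in> Ar C"
  shows "is_epi St (cl f) \<longleftrightarrow> stably_epi f"
proof
  assume m: "is_epi St (cl f)"
  show "stably_epi f" unfolding stably_epi_def
  proof (intro allI ballI impI)
    fix Y v assume v: "v \<in> Hom C (Cod C f) Y" and vf: "ft (v \<cdot> f)"
    let ?z = "Zero C (Cod C f) Y"
    have vA: "v \<in> Ar C" "Dom C v = Cod C f" "Cod C v = Y" "Y \<in> Ob C" "Dom C f \<in> Ob C" "Cod C f \<in> Ob C"
      using v f by (auto simp: cat_simps)
    have "cl (v \<cdot> f) = cl (?z \<cdot> f)"
      by (subst cl_eq_iff) (use vA f vf in \<open>simp_all add: preadd_simps\<close>)
    then have "cl v \<cdot>\<^bsub>St\<^esub> cl f = cl ?z \<cdot>\<^bsub>St\<^esub> cl f"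
      using vA f by (simp add: St_Comp preadd_simps)
    moreover have "cl v \<in> Hom St (Cod St (cl f)) Y" "cl ?z \<in> Hom St (Cod St (cl f)) Y"
      unfolding St_Cod[OF f] using vA by (intro cl_in_Hom, simp add: preadd_simps)+
    ultimately have "cl v = cl ?z" using m unfolding is_epi_def by blast
    then have "ft (v \<boxminus> ?z)" using cl_eq_iff[of v ?z] vA by (simp add: preadd_simps)
    then show "ft v" using vA by (simp add: preadd_simps)
  qed
next
  assume m: "stably_epi f"
  show "is_epi St (cl f)" unfolding is_epi_def
  proof (intro conjI allI ballI impI)
    show "cl f \<in> Ar St" using f St_Ar by blast
    fix Y G H assume "G \<in> Hom St (Cod St (cl f)) Y" "H \<in> Hom St (Cod St (cl f)) Y"
      and eq: "G \<cdot>\<^bsub>St\<^esub> cl f = H \<cdot>\<^bsub>St\<^esub> cl f"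
    then obtain g h where g: "g \<in> Hom C (Cod C f) Y" "G = cl g" and h: "h \<in> Hom C (Cod C f) Y" "H = cl h"
      using f by (auto simp: St_Hom St_Cod)
    have A: "g \<in> Ar C" "h \<in> Ar C" "Cod C g = Y" "Cod C h = Y" "Dom C g = Cod C f" "Dom C h = Cod C f"
      using g h by (auto simp: Hom_def)
    have "cl (g \<cdot> f) = cl (h \<cdot> f)" using eq A f unfolding g h by (simp add: St_Comp)
    then have "ft ((g \<boxminus> h) \<cdot> f)"
      using cl_eq_iff[of "g \<cdot> f" "h \<cdot> f"] A f by (simp add: preadd_simps)
    then have "ft (g \<boxminus> h)" using m A unfolding stably_epi_def by (simp add: preadd_simps)
    then show "G = H" unfolding g h using cl_eq_iff[of g h] A by simp
  qed
qed

lemma St_iso_iff: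
  assumes f: "f \<in> Ar C"
  shows "is_iso St (cl f) \<longleftrightarrow> (\<exists>g \<in> Hom C (Cod C f) (Dom C f). stable_inverse f g)"
proof -
  have ob: "Dom C f \<in> Ob C" "Cod C f \<in> Ob C" using f by (auto simp: cat_simps)
  have "cl g \<cdot>\<^bsub>St\<^esub> cl f = Id St (Dom St (cl f)) \<and> cl f \<cdot>\<^bsub>St\<^esub> cl g = Id St (Cod St (cl f))
      \<longleftrightarrow> stable_inverse f g"
    if g: "g \<in> Hom C (Cod C f) (Dom C f)" for g
  proof -
    have A: "g \<in> Ar C" "Dom C g = Cod C f" "Cod C g = Dom C f" using g by (auto simp: Hom_def)
    show ?thesis
      using cl_eq_iff[of "g \<cdot> f" "Id C (Dom C f)"] cl_eq_iff[of "f \<cdot> g" "Id C (Cod C f)"] A f ob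
      by (simp add: St_Comp St_Dom St_Cod St_Id stable_inverse_def cat_simps)
  qed
  moreover have "cl f \<in> Ar St" using f St_Ar by blast
  moreover have "Hom St (Cod C f) (Dom C f) = cl ` Hom C (Cod C f) (Dom C f)"
    by (simp add: set_eq_iff St_Hom image_iff)
  ultimately show ?thesis
    unfolding is_iso_def St_Dom[OF f] St_Cod[OF f] by (simp only: bex_simps) blast
qed

lemma balanced_stable_iff:
  "balanced St \<longleftrightarrow> (\<forall>f \<in> Ar C. stably_mono f \<and> stably_epi f \<longrightarrow>
      (\<exists>g \<in> Hom C (Cod C f) (Dom C f). stable_inverse f g))"
proof -
  have "balanced St \<longleftrightarrow> (\<forall>F \<in> Ar St. is_mono St F \<and> is_epi St F \<longrightarrow> is_iso St F)"
    unfolding balanced_def is_mono_def by blast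
  also have "\<dots> \<longleftrightarrow> (\<forall>f \<in> Ar C. is_mono St (cl f) \<and> is_epi St (cl f) \<longrightarrow> is_iso St (cl f))"
    using St_Ar by metis
  finally show ?thesis using St_mono_iff St_epi_iff St_iso_iff by simp
qed

section \<open>Monomorphisms with the extension property\<close>

lemma extension_property_kernel_cong:
  assumes k: "is_kernel C f k" and k': "is_kernel C f k'" and "extension_property k"
  shows "extension_property k'"
  using assms(3) extends_within_image_kernel_cong[OF k k'] is_kernelD(3)[OF k] is_kernelD(3)[OF k']
  unfolding extension_property_def by auto

lemma ft_kernel_cong:
  assumes k: "is_kernel C f k" and k': "is_kernel C f k'" and "ft k"
  shows "ft k'"
proof -
  obtain u where u: "u \<in> Hom C (Dom C k') (Dom C k)" "k \<cdot> u = k'" by (rule kernels_factor[OF k k'])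
  then show ?thesis using ft_comp_right[OF assms(3), of u] by (auto simp: Hom_def)
qed

text \<open>Monomorphisms and epimorphisms correspond by taking cokernels and kernels, up to the choice
  of the kernel; hence the invariance required of \<open>P\<close>.\<close>

lemma monos_split_iff_epis_split:
  assumes P: "\<And>f k k'. \<lbrakk>is_kernel C f k; is_kernel C f k'; P k\<rbrakk> \<Longrightarrow> P k'"
  shows "(\<forall>\<mu>. is_mono C \<mu> \<and> P \<mu> \<longrightarrow> is_section C \<mu>) \<longleftrightarrow>
    (\<forall>f. is_epi C f \<and> P (ker_mor C f) \<longrightarrow> is_retraction C f)"
proof (intro iffI allI impI; elim conjE)
  fix f assume "\<forall>\<mu>. is_mono C \<mu> \<and> P \<mu> \<longrightarrow> is_section C \<mu>" and f: "is_epi C f" "P (ker_mor C f)"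
  moreover have k: "is_kernel C f (ker_mor C f)"
    using f(1) ker_mor_is_kernel unfolding is_epi_def by blast
  ultimately show "is_retraction C f"
    using section_iff_retraction[OF f(1) k] kernel_mono[OF k] by blast
next
  fix \<mu> assume R: "\<forall>f. is_epi C f \<and> P (ker_mor C f) \<longrightarrow> is_retraction C f"
    and \<mu>: "is_mono C \<mu>" "P \<mu>"
  define f where "f = coker_mor C \<mu>"
  have f: "is_cokernel C \<mu> f"
    unfolding f_def using \<mu>(1) coker_mor_is_cokernel unfolding is_mono_def by blast
  have k: "is_kernel C f \<mu>" by (rule mono_kernel_of_cokernel[OF \<mu>(1) f])
  have "is_kernel C f (ker_mor C f)" by (rule ker_mor_is_kernel[OF is_cokernelD(2)[OF f]])
  then have "P (ker_mor C f)" using P k \<mu>(2) by blast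
  then show "is_section C \<mu>"
    using R section_iff_retraction[OF cokernel_epi[OF f] k] cokernel_epi[OF f] by blast
qed

text \<open>Write \<open>\<mu> = b \<cdot> a\<close> with \<open>a : K \<rightarrow> P\<close> and \<open>b : P \<rightarrow> M\<close>, and let \<open>c : P \<rightarrow> Q\<close> be the
  cokernel of \<open>a\<close>. The pushout of \<open>\<mu>\<close> along \<open>a\<close> is \<open>(b, c) : P \<rightarrow> M \<oplus> Q\<close>. It inherits the
  extension property: given \<open>h'\<close> on \<open>M \<oplus> Q\<close>, take on \<open>M\<close> the extension \<open>e1\<close> for \<open>h' \<cdot> i1\<close>
  provided by \<open>\<mu>\<close>; the difference of \<open>h' \<cdot> (b, c)\<close> and \<open>e1 \<cdot> b\<close> vanishes on \<open>a\<close>, so it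
  descends to \<open>Q\<close> and gives the second component.\<close>

lemma pushout_to_\<T>:
  assumes \<mu>: "is_mono C \<mu>" "ft \<mu>" and ext: "extension_property \<mu>"
  obtains P a \<nu> S i1 where "P \<in> \<T>" "is_mono C a" "a \<in> Hom C (Dom C \<mu>) P" "\<nu> \<in> Hom C P S"
    "i1 \<in> Hom C (Cod C \<mu>) S" "i1 \<cdot> \<mu> = \<nu> \<cdot> a" "is_mono C \<nu>" "extension_property \<nu>"
proof -
  obtain P a b where P: "P \<in> \<T>" and a: "a \<in> Ar C" "Dom C a = Dom C \<mu>" "Cod C a = P"
    and b: "b \<in> Ar C" "Dom C b = P" "Cod C b = Cod C \<mu>" and ba: "\<mu> = b \<cdot> a"
    using ftE[OF \<mu>(2)] by metis
  have \<mu>A: "\<mu> \<in> Ar C" using \<mu>(1) by (simp add: is_mono_def)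
  have amono: "is_mono C a"
  proof (rule monoI[OF a(1)])
    fix X x assume x: "x \<in> Hom C X (Dom C a)" "a \<cdot> x = Zero C X (Cod C a)"
    have "\<mu> \<cdot> x = b \<cdot> (a \<cdot> x)" unfolding ba using x(1) a b by (auto simp: cat_simps)
    also have "\<dots> = Zero C X (Cod C \<mu>)" unfolding x(2) using x(1) a b by (auto simp: preadd_simps)
    finally show "x = Zero C X (Dom C a)" using monoD[OF \<mu>(1), of x X] x a by simp
  qed
  define c where "c = coker_mor C a"
  have c: "is_cokernel C a c" unfolding c_def by (rule coker_mor_is_cokernel[OF a(1)])
  note CC = is_cokernelD[OF c, unfolded a]
  obtain S i1 i2 p1 p2 where D: "is_direct_sum C (Cod C \<mu>) (Cod C c) S i1 i2 p1 p2"
    using ex_direct_sum[OF cod_in_Ob[OF \<mu>A] cod_in_Ob[OF CC(2)]] by blast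
  note DD = direct_sumD(1-15)[OF D]
  note cancel = direct_sum_cancel[OF D]
  define \<nu> where "\<nu> = i1 \<cdot> b \<boxplus> i2 \<cdot> c"
  have \<nu>: "\<nu> \<in> Ar C" "Dom C \<nu> = P" "Cod C \<nu> = S"
    unfolding \<nu>_def using b CC DD by (auto simp: preadd_simps)
  have ob: "P \<in> Ob C" using a by (auto simp: cat_simps)
  have p\<nu>: "p1 \<cdot> \<nu> = b" "p2 \<cdot> \<nu> = c"
    unfolding \<nu>_def using b CC(2,3) DD cancel ob by (auto simp: preadd_simps)
  have \<nu>a: "\<nu> \<cdot> a = i1 \<cdot> \<mu>"
    unfolding \<nu>_def ba using a b CC DD dom_in_Ob[OF \<mu>A] by (auto simp: preadd_simps)
  have \<nu>mono: "is_mono C \<nu>"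
  proof (rule monoI[OF \<nu>(1)])
    fix X x assume x: "x \<in> Hom C X (Dom C \<nu>)" "\<nu> \<cdot> x = Zero C X (Cod C \<nu>)"
    have xA: "x \<in> Ar C" "Dom C x = X" "Cod C x = P" "X \<in> Ob C" using x(1) \<nu> by (auto simp: cat_simps)
    have "(p1 \<cdot> \<nu>) \<cdot> x = Zero C X (Cod C \<mu>)" "(p2 \<cdot> \<nu>) \<cdot> x = Zero C X (Cod C c)"
      using xA x(2) \<nu> DD by (simp_all add: preadd_simps)
    then have bx: "b \<cdot> x = Zero C X (Cod C \<mu>)" and cx: "c \<cdot> x = Zero C X (Cod C c)"
      unfolding p\<nu> by auto
    obtain y where y: "y \<in> Hom C X (Dom C a)" "a \<cdot> y = x"
      using kernel_lift[OF mono_kernel_of_cokernel[OF amono c], of x X] cx xA CC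
      by (auto simp: Hom_def)
    have "\<mu> \<cdot> y = b \<cdot> x" unfolding ba y(2)[symmetric] using y(1) a b by (auto simp: cat_simps)
    then have "y = Zero C X (Dom C \<mu>)" using monoD[OF \<mu>(1), of y X] y(1) a bx by simp
    then show "x = Zero C X (Dom C \<nu>)"
      unfolding y(2)[symmetric] using a \<nu> xA(4) by (simp add: comp_zero)
  qed
  have "extends_within_image C \<nu> h'" if T: "T \<in> \<T>" and h': "h' \<in> Hom C S T" for T h'
  proof -
    have h'A: "h' \<in> Ar C" "Dom C h' = S" "Cod C h' = T" using h' by (auto simp: Hom_def)
    have h1: "h' \<cdot> i1 \<in> Hom C (Cod C \<mu>) T" using h'A DD by (auto simp: cat_simps)
    then have "extends_within_image C \<mu> (h' \<cdot> i1)" using ext T unfolding extension_property_def by blast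
    moreover have "Cod C (h' \<cdot> i1) = T" using h1 by (simp add: Hom_def)
    ultimately obtain e1 where e1: "e1 \<in> Hom C (Cod C \<mu>) T" "e1 \<cdot> \<mu> = (h' \<cdot> i1) \<cdot> \<mu>"
      and ann: "\<And>Y y. \<lbrakk>y \<in> Hom C T Y; y \<cdot> ((h' \<cdot> i1) \<cdot> \<mu>) = Zero C (Dom C \<mu>) Y\<rbrakk>
        \<Longrightarrow> y \<cdot> e1 = Zero C (Cod C \<mu>) Y"
      unfolding extends_within_image_def by auto
    have e1A: "e1 \<in> Ar C" "Dom C e1 = Cod C \<mu>" "Cod C e1 = T" using e1(1) by (auto simp: Hom_def)
    have hia: "(h' \<cdot> \<nu>) \<cdot> a = (h' \<cdot> i1) \<cdot> \<mu>"
      using comp_assoc_Ar[of a \<nu> h'] comp_assoc_Ar[of \<mu> i1 h'] \<nu>a a \<nu> h'A DD \<mu>A by simp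
    have eba: "(e1 \<cdot> b) \<cdot> a = e1 \<cdot> \<mu>" unfolding ba using e1A a b by (simp add: cat_simps)
    have hn: "h' \<cdot> \<nu> \<in> Ar C" "Dom C (h' \<cdot> \<nu>) = P" "Cod C (h' \<cdot> \<nu>) = T"
      using h'A \<nu> by (auto simp: cat_simps)
    have eb: "e1 \<cdot> b \<in> Ar C" "Dom C (e1 \<cdot> b) = P" "Cod C (e1 \<cdot> b) = T"
      using e1A b by (auto simp: cat_simps)
    have "((h' \<cdot> \<nu>) \<boxminus> (e1 \<cdot> b)) \<cdot> a = ((h' \<cdot> \<nu>) \<cdot> a) \<boxminus> ((e1 \<cdot> b) \<cdot> a)"
      by (rule diff_comp) (use hn eb a in auto)
    also have "\<dots> = Zero C (Dom C a) T"
      unfolding hia eba e1(2) using h1 \<mu>A a(2) by (subst diff_same) (auto simp: preadd_simps)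
    finally have da: "((h' \<cdot> \<nu>) \<boxminus> (e1 \<cdot> b)) \<cdot> a = Zero C (Dom C a) T" .
    have d: "(h' \<cdot> \<nu>) \<boxminus> (e1 \<cdot> b) \<in> Hom C (Cod C a) T"
      using hn eb a(3) diff_Ar[of "h' \<cdot> \<nu>" "e1 \<cdot> b"] diff_Dom[of "h' \<cdot> \<nu>" "e1 \<cdot> b"]
        diff_Cod[of "h' \<cdot> \<nu>" "e1 \<cdot> b"]
      by (simp add: Hom_def)
    obtain e2 where e2: "e2 \<in> Hom C (Cod C c) T" "e2 \<cdot> c = (h' \<cdot> \<nu>) \<boxminus> (e1 \<cdot> b)"
      using cokernel_desc[OF c d da] .
    have e2A: "e2 \<in> Ar C" "Dom C e2 = Cod C c" "Cod C e2 = T" using e2(1) by (auto simp: Hom_def)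
    define e where "e = e1 \<cdot> p1 \<boxplus> e2 \<cdot> p2"
    have eA: "e \<in> Ar C" "Dom C e = S" "Cod C e = T"
      unfolding e_def using e1A e2A DD by (auto simp: preadd_simps)
    have "e \<cdot> \<nu> = e1 \<cdot> (p1 \<cdot> \<nu>) \<boxplus> e2 \<cdot> (p2 \<cdot> \<nu>)"
      unfolding e_def using e1A e2A DD \<nu> by (simp add: preadd_simps)
    also have "\<dots> = e1 \<cdot> b \<boxplus> ((h' \<cdot> \<nu>) \<boxminus> (e1 \<cdot> b))" unfolding p\<nu> e2(2) ..
    also have "\<dots> = h' \<cdot> \<nu>" using hn eb add_diff_swap[of "h' \<cdot> \<nu>" "e1 \<cdot> b"] by simp
    finally have e\<nu>: "e \<cdot> \<nu> = h' \<cdot> \<nu>" .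
    have "y \<cdot> e = Zero C S Y" if y: "y \<in> Hom C T Y" "y \<cdot> (h' \<cdot> \<nu>) = Zero C P Y" for Y y
    proof -
      have yA: "y \<in> Ar C" "Dom C y = T" "Cod C y = Y" "Y \<in> Ob C" using y(1) by (auto simp: cat_simps)
      have "y \<cdot> ((h' \<cdot> i1) \<cdot> \<mu>) = (y \<cdot> (h' \<cdot> \<nu>)) \<cdot> a"
        unfolding hia[symmetric] by (rule comp_assoc_Ar[symmetric]) (use hn a yA in auto)
      also have "\<dots> = Zero C (Dom C \<mu>) Y" unfolding y(2) using a yA by (simp add: zero_comp)
      finally have ye1: "y \<cdot> e1 = Zero C (Cod C \<mu>) Y" using ann y(1) by blast
      have "(y \<cdot> e2) \<cdot> c = y \<cdot> (e2 \<cdot> c)" using yA e2A CC by (simp add: cat_simps)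
      also have "\<dots> = (y \<cdot> (h' \<cdot> \<nu>)) \<boxminus> (y \<cdot> (e1 \<cdot> b))"
        unfolding e2(2) by (rule comp_diff) (use hn eb yA in auto)
      also have "y \<cdot> (e1 \<cdot> b) = (y \<cdot> e1) \<cdot> b" using yA e1A b by (simp add: cat_simps)
      also have "(y \<cdot> (h' \<cdot> \<nu>)) \<boxminus> ((y \<cdot> e1) \<cdot> b) = Zero C P Y"
        unfolding y(2) ye1 using b yA ob by (simp add: preadd_simps)
      finally have "(y \<cdot> e2) \<cdot> c = Zero C (Dom C c) Y" using CC by simp
      then have ye2: "y \<cdot> e2 = Zero C (Cod C c) Y"
        using epiD[OF cokernel_epi[OF c], of "y \<cdot> e2" Y] yA e2A by (simp add: cat_simps)
      have "y \<cdot> e = (y \<cdot> e1) \<cdot> p1 \<boxplus> (y \<cdot> e2) \<cdot> p2"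
        unfolding e_def using yA e1A e2A DD by (simp add: preadd_simps)
      then show ?thesis unfolding ye1 ye2 using DD yA by (simp add: preadd_simps)
    qed
    then show ?thesis
      unfolding extends_within_image_def \<nu> h'A using e\<nu> eA by (auto simp: Hom_def)
  qed
  then have "extension_property \<nu>" unfolding extension_property_def \<nu> by blast
  moreover have "a \<in> Hom C (Dom C \<mu>) P" "\<nu> \<in> Hom C P S" "i1 \<in> Hom C (Cod C \<mu>) S"
    using a \<nu> DD by (auto simp: Hom_def)
  ultimately show thesis using that P amono \<nu>mono \<nu>a by metis
qed

text \<open>Here \<open>(g \<cdot> \<mu>)(K) = a(K)\<close>. An extension \<open>e\<close> with values in it factors as \<open>a \<cdot> r\<close>, and
  cancelling \<open>a\<close> in \<open>a \<cdot> r \<cdot> \<mu> = a\<close> gives a retraction of \<open>\<mu>\<close>.\<close>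

lemma section_if_extends_factor:
  assumes ext: "extension_property \<mu>" and \<mu>A: "\<mu> \<in> Ar C"
    and a: "is_mono C a" "a \<in> Hom C (Dom C \<mu>) P" and P: "P \<in> \<T>"
    and g: "g \<in> Hom C (Cod C \<mu>) P" "g \<cdot> \<mu> = a"
  shows "is_section C \<mu>"
proof -
  have aA: "a \<in> Ar C" "Dom C a = Dom C \<mu>" "Cod C a = P" using a(2) by (auto simp: Hom_def)
  have "extends_within_image C \<mu> g" using ext P g unfolding extension_property_def by blast
  moreover have "Cod C g = P" using g(1) by (simp add: Hom_def)
  ultimately obtain e where e: "e \<in> Hom C (Cod C \<mu>) P" "e \<cdot> \<mu> = a"
    and ann: "\<And>Y y. \<lbrakk>y \<in> Hom C P Y; y \<cdot> a = Zero C (Dom C \<mu>) Y\<rbrakk>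
      \<Longrightarrow> y \<cdot> e = Zero C (Cod C \<mu>) Y"
    unfolding extends_within_image_def g(2) by auto
  obtain r where r: "r \<in> Hom C (Cod C \<mu>) (Dom C a)" "a \<cdot> r = e"
    using factors_through_mono[OF a(1), of e "Cod C \<mu>"] e(1) ann aA by auto
  have "a \<cdot> (r \<cdot> \<mu>) = (a \<cdot> r) \<cdot> \<mu>" using r(1) aA \<mu>A by (auto simp: cat_simps)
  then have "a \<cdot> (r \<cdot> \<mu>) = a" unfolding r(2) e(2) .
  moreover have "r \<cdot> \<mu> \<in> Hom C (Dom C a) (Dom C a)" using r(1) aA \<mu>A by (auto simp: cat_simps)
  ultimately have "r \<cdot> \<mu> = Id C (Dom C \<mu>)" using mono_comp_eq_self[OF a(1)] aA by simp
  then show ?thesis using r(1) aA \<mu>A unfolding is_section_def by auto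
qed

lemma monos_split_iff_monos_from_\<T>_split:
  "(\<forall>\<mu>. is_mono C \<mu> \<and> ft \<mu> \<and> extension_property \<mu> \<longrightarrow> is_section C \<mu>) \<longleftrightarrow>
    (\<forall>\<mu>. is_mono C \<mu> \<and> Dom C \<mu> \<in> \<T> \<and> extension_property \<mu> \<longrightarrow> is_section C \<mu>)"
proof (intro iffI allI impI; elim conjE)
  fix \<mu> assume "\<forall>\<mu>. is_mono C \<mu> \<and> ft \<mu> \<and> extension_property \<mu> \<longrightarrow> is_section C \<mu>"
    and \<mu>: "is_mono C \<mu>" "Dom C \<mu> \<in> \<T>" "extension_property \<mu>"
  moreover have "ft \<mu>"
    using ftI[of "Id C (Dom C \<mu>)" \<mu>] \<mu>(1,2) by (auto simp: is_mono_def cat_simps)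
  ultimately show "is_section C \<mu>" by blast
next
  fix \<mu> assume R: "\<forall>\<mu>. is_mono C \<mu> \<and> Dom C \<mu> \<in> \<T> \<and> extension_property \<mu> \<longrightarrow> is_section C \<mu>"
    and \<mu>: "is_mono C \<mu>" "ft \<mu>" "extension_property \<mu>"
  have \<mu>A: "\<mu> \<in> Ar C" using \<mu>(1) by (simp add: is_mono_def)
  obtain P a \<nu> S i1 where P: "P \<in> \<T>" and a: "is_mono C a" "a \<in> Hom C (Dom C \<mu>) P"
    and \<nu>: "\<nu> \<in> Hom C P S" and i1: "i1 \<in> Hom C (Cod C \<mu>) S" and sq: "i1 \<cdot> \<mu> = \<nu> \<cdot> a"
    and "is_mono C \<nu>" "extension_property \<nu>"
    using pushout_to_\<T>[OF \<mu>] .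
  then have "is_section C \<nu>" using R by (simp add: Hom_def)
  then obtain r where r: "r \<in> Hom C S P" "r \<cdot> \<nu> = Id C P"
    using \<nu> unfolding is_section_def by (auto simp: Hom_def)
  have "(r \<cdot> i1) \<cdot> \<mu> = r \<cdot> (i1 \<cdot> \<mu>)" using r(1) i1 \<mu>A by (auto simp: Hom_def comp_assoc_Ar)
  also have "\<dots> = (r \<cdot> \<nu>) \<cdot> a" unfolding sq using r(1) \<nu> a(2) by (auto simp: Hom_def comp_assoc_Ar)
  also have "\<dots> = a" unfolding r(2) using a(2) by (auto simp: cat_simps)
  finally have "(r \<cdot> i1) \<cdot> \<mu> = a" .
  moreover have "r \<cdot> i1 \<in> Hom C (Cod C \<mu>) P" using r(1) i1 by (auto simp: cat_simps)
  ultimately show "is_section C \<mu>" using section_if_extends_factor[OF \<mu>(3) \<mu>A a P] by blast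
qed

section \<open>The five conditions\<close>

lemma no_extension_iff:
  assumes \<mu>: "\<mu> \<in> Hom C K M"
  shows "(\<exists>T' \<in> \<T>. \<exists>h \<in> Hom C M T'.
      \<not> (\<exists>h' \<in> Hom C M (Img C (h \<cdot> \<mu>)). img_incl C (h \<cdot> \<mu>) \<cdot> h' \<cdot> \<mu> = h \<cdot> \<mu>)) \<longleftrightarrow>
    \<not> extension_property \<mu>"
  using \<mu> coincides_within_image_iff[OF \<mu>] unfolding extension_property_def by (auto simp: Hom_def)

lemma condition_ii_iff:
  assumes f: "f \<in> Hom C M N"
  shows "(\<forall>T \<in> \<T>. \<forall>h \<in> Hom C M T.
      \<exists>q \<in> Hom C M (Img C (h \<cdot> ker_mor C f)).
        img_proj C (h \<cdot> ker_mor C f) = q \<cdot> ker_mor C f) \<longleftrightarrow>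
    extension_property (ker_mor C f)"
proof -
  have "is_kernel C f (ker_mor C f)" using f by (intro ker_mor_is_kernel) (simp add: Hom_def)
  note K = is_kernelD[OF this]
  have M: "Cod C (ker_mor C f) = M" using K f by (simp add: Hom_def)
  have "ker_mor C f \<in> Hom C (Dom C (ker_mor C f)) M" using K f by (simp add: Hom_def)
  from img_proj_factors_iff[OF this] show ?thesis unfolding extension_property_def M by simp
qed

lemma sum_proper_iff:
  assumes f: "f \<in> Hom C M N" "is_epi C f"
  shows "(\<exists>T' \<in> \<T>. \<exists>h \<in> Hom C M T'. \<forall>g \<in> Hom C N T'.
      proper_subobject C (subobject_sum C (ker_mor C f) (ker_mor C (h \<boxminus> g \<cdot> f)))) \<longleftrightarrow>
    \<not> extension_property (ker_mor C f)"
proof -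
  have "is_kernel C f (ker_mor C f)" using f by (intro ker_mor_is_kernel) (simp add: Hom_def)
  then have M: "Cod C (ker_mor C f) = M" using is_kernelD(3) f by (auto simp: Hom_def)
  have "Dom C f = M" "Cod C f = N" using f by (auto simp: Hom_def)
  note sum = sum_with_kernel_iff[OF f(2), unfolded this]
  have "(\<exists>T' \<in> \<T>. \<exists>h \<in> Hom C M T'. \<not> (\<exists>g \<in> Hom C N T'.
      \<not> proper_subobject C (subobject_sum C (ker_mor C f) (ker_mor C (h \<boxminus> g \<cdot> f))))) \<longleftrightarrow>
    \<not> extension_property (ker_mor C f)"
    unfolding extension_property_def M by (simp add: sum del: bex_simps ball_simps) blast
  then show ?thesis by blast
qed

end

lemma all_equivalent_five:
  assumes "b \<longleftrightarrow> d" "c \<longleftrightarrow> e" "b \<longleftrightarrow> c" "a \<longleftrightarrow> d"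
  shows "all_equivalent [a, b, c, d, e]"
  using assms by (simp add: all_equivalent_def)

theorem theorem2p4p6:
  fixes A :: "('o, 'm) abcat" (structure) and \<T> :: "'o set"
  assumes "abelian_category A"
    and "\<T> \<subseteq> Ob A"
    and "\<And>P. P \<in> \<T> \<Longrightarrow> is_projective A P"
    and "closed_under_finite_direct_sums A \<T>"
    and "closed_under_direct_summands A \<T>"
  shows "all_equivalent
    [balanced (stable_category A \<T>),

     \<forall>K M. \<forall>\<mu> \<in> Hom A K M.
       is_mono A \<mu> \<and> \<not> is_section A \<mu> \<and> factors_through_class A \<T> \<mu> \<longrightarrow>
       (\<exists>T' \<in> \<T>. \<exists>h \<in> Hom A M T'.
          \<not> (\<exists>h' \<in> Hom A M (Img A (h \<cdot> \<mu>)). img_incl A (h \<cdot> \<mu>) \<cdot> h' \<cdot> \<mu> = h \<cdot> \<mu>)),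

     \<forall>T \<in> \<T>. \<forall>M. \<forall>\<mu> \<in> Hom A T M.
       is_mono A \<mu> \<and> \<not> is_section A \<mu> \<longrightarrow>
       (\<exists>T' \<in> \<T>. \<exists>h \<in> Hom A M T'.
          \<not> (\<exists>h' \<in> Hom A M (Img A (h \<cdot> \<mu>)). img_incl A (h \<cdot> \<mu>) \<cdot> h' \<cdot> \<mu> = h \<cdot> \<mu>)),

     \<forall>M N. \<forall>f \<in> Hom A M N.
       is_epi A f \<and>
       factors_through_class A \<T> (ker_mor A f) \<and>
       (\<forall>T \<in> \<T>. \<forall>h \<in> Hom A M T.
          \<exists>q \<in> Hom A M (Img A (h \<cdot> ker_mor A f)). img_proj A (h \<cdot> ker_mor A f) = q \<cdot> ker_mor A f) \<longrightarrow>
       is_retraction A f,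

     \<forall>M N. \<forall>f \<in> Hom A M N.
       is_epi A f \<and> \<not> is_retraction A f \<and> Ker A f \<in> \<T> \<longrightarrow>
       (\<exists>T' \<in> \<T>. \<exists>h \<in> Hom A M T'. \<forall>g \<in> Hom A N T'.
          proper_subobject A (subobject_sum A (ker_mor A f) (ker_mor A (h \<boxminus> g \<cdot> f))))]"
    (is "all_equivalent [?c1, ?c2, ?c3, ?c4, ?c5]")
proof -
  interpret S: projective_subcategory A \<T>
    unfolding projective_subcategory_def projective_subcategory_axioms_def using assms by blast
  have hom: "\<mu> \<in> Hom A (Dom A \<mu>) (Cod A \<mu>)" if "is_mono A \<mu> \<or> is_epi A \<mu>" for \<mu>
    using that by (auto simp: is_mono_def is_epi_def Hom_def)
  have c1: "?c1 \<longleftrightarrow>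
      (\<forall>f. is_epi A f \<and> factors_through_class A \<T> (ker_mor A f) \<and>
        S.extension_property (ker_mor A f) \<longrightarrow> is_retraction A f)"
    unfolding S.balanced_stable_iff by (rule S.bimorphisms_invertible_iff)
  have c2: "?c2 \<longleftrightarrow> (\<forall>\<mu>. is_mono A \<mu> \<and> factors_through_class A \<T> \<mu> \<and>
      S.extension_property \<mu> \<longrightarrow> is_section A \<mu>)"
    using S.no_extension_iff hom by blast
  have c3: "?c3 \<longleftrightarrow> (\<forall>\<mu>. is_mono A \<mu> \<and> Dom A \<mu> \<in> \<T> \<and> S.extension_property \<mu>
      \<longrightarrow> is_section A \<mu>)"
    (is "_ \<longleftrightarrow> ?r3")
  proof
    show ?r3 if ?c3 using that S.no_extension_iff hom by blast
    show ?c3 if ?r3 using that S.no_extension_iff unfolding Hom_def by blast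
  qed
  have c4: "?c4 \<longleftrightarrow>
      (\<forall>f. is_epi A f \<and> factors_through_class A \<T> (ker_mor A f) \<and>
        S.extension_property (ker_mor A f) \<longrightarrow> is_retraction A f)"
    using S.condition_ii_iff hom by blast
  have c5: "?c5 \<longleftrightarrow>
      (\<forall>f. is_epi A f \<and> Dom A (ker_mor A f) \<in> \<T> \<and> S.extension_property (ker_mor A f)
        \<longrightarrow> is_retraction A f)"
    unfolding Ker_def using S.sum_proper_iff hom by blast
  have "?c2 \<longleftrightarrow> ?c4" unfolding c2 c4
    by (rule S.monos_split_iff_epis_split)
      (blast intro: S.ft_kernel_cong S.extension_property_kernel_cong)
  moreover have "?c3 \<longleftrightarrow> ?c5" unfolding c3 c5
    by (rule S.monos_split_iff_epis_split)
      (blast intro: S.kernel_object_in_\<T> S.extension_property_kernel_cong)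
  moreover have "?c2 \<longleftrightarrow> ?c3" unfolding c2 c3 by (rule S.monos_split_iff_monos_from_\<T>_split)
  moreover have "?c1 \<longleftrightarrow> ?c4" unfolding c1 c4 ..
  ultimately show ?thesis by (rule all_equivalent_five)
qed

end
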